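(* Let $\mathcal{P}$ be one of the properties $\mathbf{BPBpp}$, $\mathbf{BPBop}$, $\mathbf{L}_{o,o}$ or $\mathbf{L}_{p,p}$, let $N\in\mathbb{N}$, and let $X_1,\ldots,X_N,Y$ be nonzero Banach spaces over $\mathbb{K}$. (a) If $(X_1,\ldots,X_N;Y)$ has property $\mathcal{P}$, then so does $(X_1,\ldots,X_N;\mathbb{K})$. (b) If $N\ge 2$, $(X_1,\ldots,X_N;\mathbb{K})$ has property $\mathcal{P}$, and $\mathcal{P}$ is not $\mathbf{L}_{p,p}$, then $(X_1,\ldots,X_{N-1};X_N^* )$ has property $\mathcal{P}$. (c) If $(X_1,\ldots,X_N;Y)$ has property $\mathcal{P}$, then so does $(X_i;\mathbb{K})$ for every $1\le i\le N$.
   Context: Banach spaces are over $\mathbb{K}=\mathbb{R}$ or $\mathbb{C}$; $S_X$ is the unit sphere and $X^*$ the topological dual of $X$. $\mathcal{L}(X_1,\ldots,X_N;Y)$ is the space of bounded $N$-linear maps $X_1\times\cdots\times X_N\to Y$, with $\|A\|=\sup\{\|A(x_1,\ldots,x_N)\|: x_i\in S_{X_i}\}$. Write $x=(x_1,\ldots,x_N)$, $S=S_{X_1}\times\cdots\times S_{X_N}$ and $\mathcal{L}=\mathcal{L}(X_1,\ldots,X_N;Y)$. $(X_1,\ldots,X_N;Y)$ has: - $\mathbf{BPBpp}$ if for every $\varepsilon>0$ there is $\eta(\varepsilon)>0$ such that whenever $A\in\mathcal{L}$, $\|A\|=1$ and $x\in S$ satisfy $\|A(x)\|>1-\eta(\varepsilon)$,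 there is $B\in\mathcal{L}$ with $\|B\|=1$, $\|B(x)\|=1$ and $\|B-A\|<\varepsilon$. - $\mathbf{BPBop}$ if for every $\varepsilon>0$ there is $\eta(\varepsilon)>0$ such that whenever $A\in\mathcal{L}$, $\|A\|=1$ and $x\in S$ satisfy $\|A(x)\|>1-\eta(\varepsilon)$, there is $z=(z_1,\ldots,z_N)\in S$ with $\|A(z)\|=1$ and $\max_j\|x_j-z_j\|<\varepsilon$. - $\mathbf{L}_{p,p}$ if for every $\varepsilon>0$ and $x\in S$ there is $\eta(\varepsilon,x)>0$ such that whenever $A\in\mathcal{L}$ with $\|A\|=1$ satisfies $\|A(x)\|>1-\eta(\varepsilon,x)$, there is $B\in\mathcal{L}$ with $\|B\|=1$, $\|B(x)\|=1$ and $\|B-A\|<\varepsilon$. - $\mathbf{L}_{o,o}$ if for every $\varepsilon>0$ and $A\in\mathcal{L}$ with $\|A\|=1$ there is $\eta(\varepsilon,A)>0$ such that whenever $x\in S$ satisfies $\|A(x)\|>1-\eta(\varepsilon,A)$, there is $z=(z_1,\ldots,z_N)\in S$ with $\|A(z)\|=1$ and $\max_j\|x_j-z_j\|<\varepsilon$. *)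

theory Defs
  imports "HOL-Analysis.Analysis" "HOL-Algebra.Module"
begin

text \<open>
  The scalar field is a type of the following class, i.e. a normed field that is isometrically
  isomorphic to \<open>\<real>\<close> or to \<open>\<complex>\<close>.
\<close>

class real_or_complex = real_normed_field +
  assumes isometric_to_real_or_complex:
    "(\<exists>h :: 'a \<Rightarrow> real. bij h \<and> (\<forall>x y. h (x + y) = h x + h y) \<and> (\<forall>x y. h (x * y) = h x * h y)
        \<and> (\<forall>x. norm (h x) = norm x)) \<or>
     (\<exists>h :: 'a \<Rightarrow> complex. bij h \<and> (\<forall>x y. h (x + y) = h x + h y) \<and> (\<forall>x y. h (x * y) = h x * h y)
        \<and> (\<forall>x. norm (h x) = norm x))"

instance real :: real_or_complex
  by standard (rule disjI1, rule exI[of _ id], simp)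

instance complex :: real_or_complex
  by standard (rule disjI2, rule exI[of _ id], simp)

definition scalar_ring :: "('k::real_or_complex) ring" where
  "scalar_ring = \<lparr>carrier = UNIV, mult = (*), one = 1, zero = 0, add = (+)\<rparr>"

text \<open>
  Spaces are carrier based, so that finite families of different spaces, and the dual of a member
  of such a family, are values of a HOL type. The fields \<^const>\<open>mult\<close> and \<^const>\<open>one\<close>, which
  HOL-Algebra modules inherit from rings, are irrelevant.
\<close>

record ('k, 'a) normed_space = "('k, 'a) module" +
  vnorm :: "'a \<Rightarrow> real"

text \<open>
  The locale \<^locale>\<open>Metric_space\<close> asks for nonnegativity and symmetry also outside the carrier.
\<close>

definition norm_dist :: "('k, 'a) normed_space \<Rightarrow> 'a \<Rightarrow> 'a \<Rightarrow> real" where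
  "norm_dist X v w =
     (if v \<in> carrier X \<and> w \<in> carrier X then vnorm X (v \<ominus>\<^bsub>X\<^esub> w) else 0)"

locale banach_space = module scalar_ring X
  for X :: "('k::real_or_complex, 'a) normed_space" (structure) +
  assumes vnorm_nonneg: "v \<in> carrier X \<Longrightarrow> 0 \<le> vnorm X v"
    and vnorm_eq_0_iff: "v \<in> carrier X \<Longrightarrow> vnorm X v = 0 \<longleftrightarrow> v = \<zero>"
    and vnorm_smult: "v \<in> carrier X \<Longrightarrow> vnorm X (c \<odot> v) = norm c * vnorm X v"
    and vnorm_triangle:
      "v \<in> carrier X \<Longrightarrow> w \<in> carrier X \<Longrightarrow> vnorm X (v \<oplus> w) \<le> vnorm X v + vnorm X w"
    and complete: "Metric_space.mcomplete (carrier X) (norm_dist X)"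
begin

lemma vnorm_uminus: "v \<in> carrier X \<Longrightarrow> vnorm X (\<ominus> v) = vnorm X v"
proof -
  assume v: "v \<in> carrier X"
  have "(- 1) \<odot> v \<oplus> v = (- 1) \<odot> v \<oplus> 1 \<odot> v"
    using smult_one[OF v] by (simp add: scalar_ring_def)
  also have "\<dots> = (- 1 + 1) \<odot> v"
    using smult_l_distr[of "- 1" 1 v] v by (simp add: scalar_ring_def)
  also have "\<dots> = \<zero>"
    using smult_l_null[OF v] by (simp add: scalar_ring_def)
  finally have "\<ominus> v = (- 1) \<odot> v"
    using v smult_closed[of "- 1" v] by (metis M.minus_equality UNIV_I scalar_ring_def partial_object.select_convs(1))
  then show ?thesis
    using vnorm_smult[OF v, of "- 1"] by simp
qed

lemma Metric_space_norm_dist: "Metric_space (carrier X) (norm_dist X)"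
proof
  show "0 \<le> norm_dist X v w" for v w
    by (simp add: norm_dist_def vnorm_nonneg)
  show "norm_dist X v w = norm_dist X w v" for v w
  proof (cases "v \<in> carrier X \<and> w \<in> carrier X")
    case True
    then have "\<ominus> (v \<ominus> w) = w \<ominus> v"
      by (simp add: M.minus_eq M.minus_add M.a_comm)
    then show ?thesis
      using True vnorm_uminus[of "v \<ominus> w"] by (simp add: norm_dist_def)
  qed (auto simp: norm_dist_def)
  show "norm_dist X v w = 0 \<longleftrightarrow> v = w" if "v \<in> carrier X" "w \<in> carrier X" for v w
  proof -
    have "v \<ominus> w = \<zero> \<longleftrightarrow> v = w"
      using that M.minus_equality[of v "\<ominus> w"] by (auto simp: M.minus_eq M.r_neg)
    then show ?thesis
      using that by (simp add: norm_dist_def vnorm_eq_0_iff)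
  qed
  show "norm_dist X u w \<le> norm_dist X u v + norm_dist X v w"
    if "u \<in> carrier X" "v \<in> carrier X" "w \<in> carrier X" for u v w
  proof -
    have "u \<ominus> w = (u \<ominus> v) \<oplus> (v \<ominus> w)"
      using that by (simp add: M.minus_eq M.a_assoc M.r_neg2 M.r_neg1)
    then show ?thesis
      using that vnorm_triangle[of "u \<ominus> v" "v \<ominus> w"] by (simp add: norm_dist_def)
  qed
qed

end

definition unit_sphere :: "('k, 'a) normed_space \<Rightarrow> 'a set" where
  "unit_sphere X = {v \<in> carrier X. vnorm X v = 1}"

definition scalar_space :: "('k::real_or_complex, 'k) normed_space" where
  "scalar_space = \<lparr>carrier = UNIV, mult = (*), one = 1, zero = 0, add = (+), smult = (*), vnorm = norm\<rparr>"

lemma banach_space_scalar_space: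
  "banach_space (scalar_space :: ('k::{real_or_complex, banach}, 'k) normed_space)"
proof -
  let ?K = "scalar_space :: ('k, 'k) normed_space"
  have cring: "cring (scalar_ring :: 'k ring)"
    by (rule cringI, rule abelian_groupI, unfold scalar_ring_def)
      (auto intro!: comm_monoidI simp: algebra_simps intro: exI[of _ "- x" for x] left_minus)
  have ag: "abelian_group ?K"
    by (rule abelian_groupI)
      (auto simp: scalar_space_def algebra_simps intro: exI[of _ "- x" for x] left_minus)
  have module: "module scalar_ring ?K"
    by (rule moduleI[OF cring ag]) (auto simp: scalar_ring_def scalar_space_def algebra_simps)
  interpret M: module scalar_ring ?K by (fact module)
  have "\<ominus>\<^bsub>?K\<^esub> y = - y" for y
    by (rule M.minus_equality) (auto simp: scalar_space_def)
  then have dist: "norm_dist ?K = dist"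
    by (intro ext) (simp add: norm_dist_def M.minus_eq, simp add: scalar_space_def dist_norm)
  have carr: "carrier ?K = UNIV" by (simp add: scalar_space_def)
  have "Metric_space.mcomplete (UNIV :: 'k set) dist"
    using complete_UNIV[where 'a='k] by simp
  then show ?thesis
    by unfold_locales (simp_all add: dist carr, simp_all add: scalar_space_def norm_mult norm_triangle_ineq)
qed

text \<open>Functionals are extensional: they are \<^const>\<open>undefined\<close> outside the carrier. The suprema
  defining operator norms are meaningful for nonzero spaces, whose unit spheres are nonempty.\<close>

definition dual_space ::
  "('k::real_or_complex, 'a) normed_space \<Rightarrow> ('k, 'a \<Rightarrow> 'k) normed_space" where
  "dual_space X =
     \<lparr>carrier = {f \<in> carrier X \<rightarrow>\<^sub>E UNIV.
        (\<forall>v\<in>carrier X. \<forall>w\<in>carrier X. f (v \<oplus>\<^bsub>X\<^esub> w) = f v + f w) \<and>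
        (\<forall>c. \<forall>v\<in>carrier X. f (c \<odot>\<^bsub>X\<^esub> v) = c * f v) \<and>
        (\<exists>C. \<forall>v\<in>carrier X. norm (f v) \<le> C * vnorm X v)},
      mult = undefined, one = undefined,
      zero = (\<lambda>v\<in>carrier X. 0),
      add = (\<lambda>f g. \<lambda>v\<in>carrier X. f v + g v),
      smult = (\<lambda>c f. \<lambda>v\<in>carrier X. c * f v),
      vnorm = (\<lambda>f. SUP v\<in>unit_sphere X. norm (f v))\<rparr>"

text \<open>
  A family \<open>X\<^sub>1, \<dots>, X\<^sub>N\<close> is given by the values of \<open>X\<close> on \<open>{1..N}\<close>. Its members live in one HOL type,
  but since they may have arbitrary carriers and operations, this type can be a disjoint sum of
  different types. Elements of a product are extensional functions on \<open>{1..N}\<close>.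
\<close>

definition multilinear_maps ::
  "nat \<Rightarrow> (nat \<Rightarrow> ('k::real_or_complex, 'a) normed_space) \<Rightarrow> ('k, 'b) normed_space
     \<Rightarrow> ((nat \<Rightarrow> 'a) \<Rightarrow> 'b) set" where
  "multilinear_maps N X Y =
     {A \<in> (\<Pi>\<^sub>E i\<in>{1..N}. carrier (X i)) \<rightarrow>\<^sub>E carrier Y.
        (\<forall>x \<in> \<Pi>\<^sub>E i\<in>{1..N}. carrier (X i). \<forall>i\<in>{1..N}.
           (\<forall>v\<in>carrier (X i). \<forall>w\<in>carrier (X i).
              A (x(i := v \<oplus>\<^bsub>X i\<^esub> w)) = A (x(i := v)) \<oplus>\<^bsub>Y\<^esub> A (x(i := w))) \<and>
           (\<forall>c. \<forall>v\<in>carrier (X i). A (x(i := c \<odot>\<^bsub>X i\<^esub> v)) = c \<odot>\<^bsub>Y\<^esub> A (x(i := v))))}"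

definition bounded_multilinear_maps ::
  "nat \<Rightarrow> (nat \<Rightarrow> ('k::real_or_complex, 'a) normed_space) \<Rightarrow> ('k, 'b) normed_space
     \<Rightarrow> ((nat \<Rightarrow> 'a) \<Rightarrow> 'b) set" where
  "bounded_multilinear_maps N X Y =
     {A \<in> multilinear_maps N X Y.
        \<exists>C. \<forall>x \<in> \<Pi>\<^sub>E i\<in>{1..N}. carrier (X i). vnorm Y (A x) \<le> C * (\<Prod>i=1..N. vnorm (X i) (x i))}"

definition spheres :: "nat \<Rightarrow> (nat \<Rightarrow> ('k, 'a) normed_space) \<Rightarrow> (nat \<Rightarrow> 'a) set" where
  "spheres N X = (\<Pi>\<^sub>E i\<in>{1..N}. unit_sphere (X i))"

definition opnorm ::
  "nat \<Rightarrow> (nat \<Rightarrow> ('k, 'a) normed_space) \<Rightarrow> ('k, 'b) normed_space \<Rightarrow> ((nat \<Rightarrow> 'a) \<Rightarrow> 'b) \<Rightarrow> real" where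
  "opnorm N X Y A = (SUP x\<in>spheres N X. vnorm Y (A x))"

definition map_diff ::
  "nat \<Rightarrow> (nat \<Rightarrow> ('k, 'a) normed_space) \<Rightarrow> ('k, 'b) normed_space
     \<Rightarrow> ((nat \<Rightarrow> 'a) \<Rightarrow> 'b) \<Rightarrow> ((nat \<Rightarrow> 'a) \<Rightarrow> 'b) \<Rightarrow> ((nat \<Rightarrow> 'a) \<Rightarrow> 'b)" where
  "map_diff N X Y B A = (\<lambda>x \<in> \<Pi>\<^sub>E i\<in>{1..N}. carrier (X i). B x \<ominus>\<^bsub>Y\<^esub> A x)"

definition tuple_dist ::
  "nat \<Rightarrow> (nat \<Rightarrow> ('k, 'a) normed_space) \<Rightarrow> (nat \<Rightarrow> 'a) \<Rightarrow> (nat \<Rightarrow> 'a) \<Rightarrow> real" where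
  "tuple_dist N X x z = Max ((\<lambda>j. vnorm (X j) (x j \<ominus>\<^bsub>X j\<^esub> z j)) ` {1..N})"

definition has_BPBpp ::
  "nat \<Rightarrow> (nat \<Rightarrow> ('k::real_or_complex, 'a) normed_space) \<Rightarrow> ('k, 'b) normed_space \<Rightarrow> bool" where
  "has_BPBpp N X Y \<longleftrightarrow>
     (\<forall>\<epsilon>>0. \<exists>\<eta>>0. \<forall>A\<in>bounded_multilinear_maps N X Y. \<forall>x\<in>spheres N X.
        opnorm N X Y A = 1 \<longrightarrow> vnorm Y (A x) > 1 - \<eta> \<longrightarrow>
        (\<exists>B\<in>bounded_multilinear_maps N X Y.
           opnorm N X Y B = 1 \<and> vnorm Y (B x) = 1 \<and> opnorm N X Y (map_diff N X Y B A) < \<epsilon>))"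

definition has_BPBop ::
  "nat \<Rightarrow> (nat \<Rightarrow> ('k::real_or_complex, 'a) normed_space) \<Rightarrow> ('k, 'b) normed_space \<Rightarrow> bool" where
  "has_BPBop N X Y \<longleftrightarrow>
     (\<forall>\<epsilon>>0. \<exists>\<eta>>0. \<forall>A\<in>bounded_multilinear_maps N X Y. \<forall>x\<in>spheres N X.
        opnorm N X Y A = 1 \<longrightarrow> vnorm Y (A x) > 1 - \<eta> \<longrightarrow>
        (\<exists>z\<in>spheres N X. vnorm Y (A z) = 1 \<and> tuple_dist N X x z < \<epsilon>))"

definition has_Lpp ::
  "nat \<Rightarrow> (nat \<Rightarrow> ('k::real_or_complex, 'a) normed_space) \<Rightarrow> ('k, 'b) normed_space \<Rightarrow> bool" where
  "has_Lpp N X Y \<longleftrightarrow>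
     (\<forall>\<epsilon>>0. \<forall>x\<in>spheres N X. \<exists>\<eta>>0. \<forall>A\<in>bounded_multilinear_maps N X Y.
        opnorm N X Y A = 1 \<longrightarrow> vnorm Y (A x) > 1 - \<eta> \<longrightarrow>
        (\<exists>B\<in>bounded_multilinear_maps N X Y.
           opnorm N X Y B = 1 \<and> vnorm Y (B x) = 1 \<and> opnorm N X Y (map_diff N X Y B A) < \<epsilon>))"

definition has_Loo ::
  "nat \<Rightarrow> (nat \<Rightarrow> ('k::real_or_complex, 'a) normed_space) \<Rightarrow> ('k, 'b) normed_space \<Rightarrow> bool" where
  "has_Loo N X Y \<longleftrightarrow>
     (\<forall>\<epsilon>>0. \<forall>A\<in>bounded_multilinear_maps N X Y. opnorm N X Y A = 1 \<longrightarrow>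
        (\<exists>\<eta>>0. \<forall>x\<in>spheres N X. vnorm Y (A x) > 1 - \<eta> \<longrightarrow>
           (\<exists>z\<in>spheres N X. vnorm Y (A z) = 1 \<and> tuple_dist N X x z < \<epsilon>)))"

text \<open>
  Names for the four properties: a HOL variable ranging over the predicates themselves could not be
  applied to range spaces of different types.
\<close>

datatype bpb_property = BPBpp | BPBop | Loo | Lpp

primrec has_property ::
  "bpb_property \<Rightarrow> nat \<Rightarrow> (nat \<Rightarrow> ('k::real_or_complex, 'a) normed_space) \<Rightarrow> ('k, 'b) normed_space
     \<Rightarrow> bool" where
  "has_property BPBpp N X Y = has_BPBpp N X Y"
| "has_property BPBop N X Y = has_BPBop N X Y"
| "has_property Loo N X Y = has_Loo N X Y"
| "has_property Lpp N X Y = has_Lpp N X Y"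

end

(*
  Norming functionals come from Hahn-Banach, in the form that a minimal sublinear functional is
  linear. For (a), a scalar map A is sent to A(.) y with y a unit vector; a norm-attaining
  approximant of A(.) y is turned into a scalar one by composing it with a functional norming its
  value at x and rotating. For (b), a map into the dual of the last space is a scalar map in one more
  variable, isometrically. For (c), reduce to scalar maps by (a) and tensor a functional on one
  factor with functionals norming fixed unit vectors of the other factors; freezing these vectors
  recovers the functional.
*)

theory Submission
  imports Defs
begin

text \<open>The order of choices shapes the transfer. A p-property may attach its threshold to a
  point, so the new point must be chosen before the map; an o-property may attach it to a map, so
  the new map must be chosen before the point. In (a) and (c) the new point depends only on the old
  point and the new map only on the old map, which suits all four properties. In (b) the added
  coordinate is a unit vector at which the functional A(x) nearly reaches its norm, so it depends on
  the map as well. That is harmless if the threshold is uniform or attached to the map, but the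
  argument breaks down for \<open>Lpp\<close>.

  In (a) the error doubles. Let B be within \<delta> of A(.) y and let f norm B(x). Since f(B(x)) =
  1 and |A(x)| \<le> 1, it follows that |f(y)| \<ge> 1 - \<delta>, and the rotated composition
  differs from A by at most \<delta> + (1 - |f(y)|) \<le> 2 \<delta>.

  In (c) the functionals on the other factors have norm one, so a point where the tensor has modulus
  one projects to a point where the given functional attains its norm.\<close>

section \<open>Scalars\<close>

text \<open>\<open>h 1\<close> is a nonzero idempotent, hence 1. So \<open>h r\<close> has the same
  distances to 0 and to 1 as the real number r; by polarization it has the same inner product with
  1, and the squared distance from \<open>h r\<close> to r expands to 0. The type \<open>'c\<close>
  with an inner product covers real and complex targets at once.\<close>

lemma isometric_hom_of_real:
  fixes h :: "'k::real_or_complex \<Rightarrow> 'c::{real_normed_field,real_inner}"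
  assumes add: "\<And>x y. h (x + y) = h x + h y"
    and mult: "\<And>x y. h (x * y) = h x * h y"
    and iso: "\<And>x. norm (h x) = norm x"
  shows "h (of_real r) = of_real r"
proof -
  have "h 1 * h 1 = h 1 * 1" by (metis mult mult_1_right)
  moreover have "h 1 \<noteq> 0" using iso[of 1] by auto
  ultimately have h1: "h 1 = 1" by simp
  have "h (of_real r - 1) + h 1 = h (of_real r)"
    by (simp flip: add)
  then have diff: "h (of_real r - 1) = h (of_real r) - 1"
    using h1 by (simp add: algebra_simps)
  have eq1: "norm (h (of_real r)) = norm (of_real r :: 'c)"
    by (simp add: iso)
  have eq2: "norm (h (of_real r) - 1) = norm (of_real r - 1 :: 'c)"
  proof -
    have "norm (h (of_real r) - 1) = norm (of_real (r - 1) :: 'k)"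
      using iso[of "of_real r - 1"] by (simp add: diff)
    also have "\<dots> = norm (of_real (r - 1) :: 'c)"
      by (simp only: norm_of_real)
    finally show ?thesis by simp
  qed
  define w where "w = h (of_real r)"
  have sq: "(norm (u - v))\<^sup>2 = (norm u)\<^sup>2 - 2 * (u \<bullet> v) + (norm v)\<^sup>2" for u v :: 'c
    by (simp add: power2_norm_eq_inner inner_diff_left inner_diff_right inner_commute)
  have "w \<bullet> 1 = of_real r \<bullet> (1::'c)"
    using sq[of w 1] sq[of "of_real r" 1] eq1 eq2 by (simp add: w_def)
  then have "w \<bullet> of_real r = of_real r \<bullet> (of_real r :: 'c)"
    by (simp add: of_real_def)
  then have "(norm (w - of_real r))\<^sup>2 = 0"
    using sq[of w "of_real r"] eq1 by (simp add: w_def dot_square_norm)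
  then show ?thesis by (simp add: w_def)
qed

text \<open>Pulls the isomorphism back into the scalar type: Hahn-Banach then needs only a square
  root \<open>j\<close> of -1. The norm formula makes real and imaginary parts unique and is what
  gives access to them.\<close>

lemma real_or_complex_cases:
  obtains (real) "\<And>c :: 'k::real_or_complex. \<exists>a. c = of_real a"
  | (complex) j :: "'k::real_or_complex" where "j * j = -1"
      "\<And>c :: 'k::real_or_complex. \<exists>a b. c = of_real a + of_real b * j"
      "\<And>a b. norm (of_real a + of_real b * j) = sqrt (a\<^sup>2 + b\<^sup>2)"
proof -
  consider
    (r) h :: "'k \<Rightarrow> real" where "bij h" "\<And>x y. h (x + y) = h x + h y" "\<And>x y. h (x * y) = h x * h y"
      "\<And>x. norm (h x) = norm x"
  | (c) h :: "'k \<Rightarrow> complex" where "bij h" "\<And>x y. h (x + y) = h x + h y"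
      "\<And>x y. h (x * y) = h x * h y" "\<And>x. norm (h x) = norm x"
    using isometric_to_real_or_complex[where 'a='k] by metis
  then show thesis
  proof cases
    case r
    have "h c = h (of_real (h c))" for c
      using isometric_hom_of_real[of h "h c"] r by simp
    then show thesis using r(1) real bij_is_inj[OF r(1)] by (metis injD)
  next
    case c
    note h_of_real = isometric_hom_of_real[of h, OF c(2,3,4)]
    obtain j where hj: "h j = \<i>"
      using c(1) by (metis bij_pointE)
    have hab: "h (of_real a + of_real b * j) = Complex a b" for a b
      by (simp add: c(2,3) h_of_real hj Complex_eq mult.commute)
    have "h (j * j) = h (of_real (-1))"
      unfolding h_of_real by (simp add: c(3) hj)
    then have "j * j = -1"
      using c(1) by (auto dest: bij_is_inj injD)
    moreover have "\<exists>a b. x = of_real a + of_real b * j" for x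
      using hab[of "Re (h x)" "Im (h x)"] bij_is_inj[OF c(1)] by (metis complex_surj injD)
    moreover have "norm (of_real a + of_real b * j) = sqrt (a\<^sup>2 + b\<^sup>2)" for a b
      using c(4)[of "of_real a + of_real b * j"] by (simp add: hab cmod_def)
    ultimately show thesis using complex by blast
  qed
qed

lemma carrier_scalar_ring [simp]: "carrier scalar_ring = UNIV"
  and add_scalar_ring [simp]: "add scalar_ring = (+)"
  and mult_scalar_ring [simp]: "mult scalar_ring = (*)"
  and one_scalar_ring [simp]: "one scalar_ring = 1"
  and zero_scalar_ring [simp]: "zero scalar_ring = 0"
  by (simp_all add: scalar_ring_def)

lemma carrier_scalar_space [simp]: "carrier scalar_space = UNIV"
  and add_scalar_space [simp]: "add scalar_space = (+)"
  and zero_scalar_space [simp]: "zero scalar_space = 0"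
  and smult_scalar_space [simp]: "smult scalar_space = (*)"
  and vnorm_scalar_space [simp]: "vnorm scalar_space = norm"
  by (simp_all add: scalar_space_def)

text \<open>The operation \<open>\<ominus>\<close> is defined through the inverse in the additive
  group, which the group laws identify with ordinary negation.\<close>

lemma minus_scalar_space [simp]:
  fixes x y :: "'k::real_or_complex"
  shows "x \<ominus>\<^bsub>scalar_space\<^esub> y = x - y"
proof -
  interpret abelian_group "scalar_space :: ('k, 'k) normed_space"
    by (rule abelian_groupI) (auto simp: algebra_simps intro: exI[of _ "- x" for x] left_minus)
  have "\<ominus>\<^bsub>scalar_space\<^esub> y = - y"
    by (rule minus_equality) auto
  then show ?thesis by (simp add: a_minus_def)
qed

section \<open>Norming functionals\<close>

text \<open>The third clause makes the pointwise order antisymmetric on functionals of this kind.\<close>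

definition sublinear_on :: "('k::real_or_complex, 'a) normed_space \<Rightarrow> ('a \<Rightarrow> real) \<Rightarrow> bool" where
  "sublinear_on X p \<longleftrightarrow>
     (\<forall>v\<in>carrier X. \<forall>w\<in>carrier X. p (v \<oplus>\<^bsub>X\<^esub> w) \<le> p v + p w) \<and>
     (\<forall>t\<ge>0. \<forall>v\<in>carrier X. p (of_real t \<odot>\<^bsub>X\<^esub> v) \<le> t * p v) \<and>
     (\<forall>v. v \<notin> carrier X \<longrightarrow> p v = 0)"

context banach_space
begin

section \<open>Scalar multiplication and norm in a Banach space\<close>

lemma smult_add_scalar:
  "v \<in> carrier X \<Longrightarrow> (a + b) \<odot> v = a \<odot> v \<oplus> b \<odot> v"
  using smult_l_distr[of a b v] by simp

lemma smult_add_vector: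
  "v \<in> carrier X \<Longrightarrow> w \<in> carrier X \<Longrightarrow> a \<odot> (v \<oplus> w) = a \<odot> v \<oplus> a \<odot> w"
  using smult_r_distr[of a v w] by simp

lemma smult_smult: "v \<in> carrier X \<Longrightarrow> a \<odot> (b \<odot> v) = (a * b) \<odot> v"
  using smult_assoc1[of a b v] by simp

lemma smult_1: "v \<in> carrier X \<Longrightarrow> 1 \<odot> v = v"
  using smult_one[of v] by simp

lemma smult_0: "v \<in> carrier X \<Longrightarrow> 0 \<odot> v = \<zero>"
  using smult_l_null[of v] by simp

lemma smult_carrier [simp]: "v \<in> carrier X \<Longrightarrow> a \<odot> v \<in> carrier X"
  by (rule smult_closed) simp_all

lemma smult_minus_1: "v \<in> carrier X \<Longrightarrow> (- 1) \<odot> v = \<ominus> v"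
  by (rule M.minus_equality[symmetric])
    (use smult_add_scalar[of v "-1" 1] in \<open>simp_all add: smult_1 smult_0\<close>)

lemma vnorm_zero: "vnorm X \<zero> = 0"
  by (simp add: vnorm_eq_0_iff)

lemma vnorm_minus_le:
  "v \<in> carrier X \<Longrightarrow> w \<in> carrier X \<Longrightarrow> vnorm X (v \<ominus> w) \<le> vnorm X v + vnorm X w"
  using vnorm_triangle[of v "\<ominus> w"] vnorm_uminus[of w] by (simp add: M.minus_eq)

section \<open>Sublinear functionals: homogeneity, tilts, infima of chains\<close>

lemma sublinear_zero:
  assumes "sublinear_on X p"
  shows "p \<zero> = 0"
proof (rule antisym)
  have "p (of_real 0 \<odot> \<zero>) \<le> 0 * p \<zero>"
    using assms M.zero_closed unfolding sublinear_on_def by blast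
  then show "p \<zero> \<le> 0" by (simp add: smult_0)
  have "p (\<zero> \<oplus> \<zero>) \<le> p \<zero> + p \<zero>"
    using assms M.zero_closed unfolding sublinear_on_def by blast
  then show "0 \<le> p \<zero>" by simp
qed

text \<open>The definition asks only for \<open>\<le>\<close>, the form that passes easily to
  infima; using it for t and for 1/t yields equality.\<close>

lemma sublinear_homogeneous:
  assumes p: "sublinear_on X p" and "0 \<le> t" "v \<in> carrier X"
  shows "p (of_real t \<odot> v) = t * p v"
proof (cases "t = 0")
  case True
  then show ?thesis using assms by (simp add: smult_0 sublinear_zero)
next
  case False
  then have t: "t > 0" using assms by simp
  have "p (of_real t \<odot> v) \<le> t * p v"
    using assms unfolding sublinear_on_def by blast
  moreover have "p (of_real (1/t) \<odot> (of_real t \<odot> v)) \<le> 1/t * p (of_real t \<odot> v)"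
    using assms t smult_carrier[of v] unfolding sublinear_on_def by (meson divide_nonneg_pos zero_le_one)
  ultimately show ?thesis
    using t assms by (simp add: smult_smult smult_1 field_simps)
qed

lemma sublinear_ge:
  assumes "sublinear_on X p" "v \<in> carrier X"
  shows "- p (\<ominus> v) \<le> p v"
proof -
  have "p (v \<oplus> \<ominus> v) \<le> p v + p (\<ominus> v)"
    using assms M.a_inv_closed unfolding sublinear_on_def by blast
  then show ?thesis using assms by (simp add: M.r_neg sublinear_zero)
qed

text \<open>Take q(y) as the infimum of p(y + t x) - t p(x) over t \<ge> 0. The value t = 0 gives q
  \<le> p and t = 1 gives the last inequality. For minimal p it forces q = p, hence superadditivity;
  for the norm it yields q(-x) \<le> -|x|, which prescribes the value at x of any linear functional
  below q.\<close>

lemma sublinear_tilt: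
  assumes p: "sublinear_on X p" and x: "x \<in> carrier X"
  shows "\<exists>q. sublinear_on X q \<and> q \<le> p \<and> (\<forall>y\<in>carrier X. q y \<le> p (y \<oplus> x) - p x)"
proof -
  define f where "f y t = p (y \<oplus> of_real t \<odot> x) - t * p x" for y t
  define q where "q y = (if y \<in> carrier X then INF t\<in>{0..}. f y t else 0)" for y
  have sub: "p (v \<oplus> w) \<le> p v + p w" if "v \<in> carrier X" "w \<in> carrier X" for v w
    using p that unfolding sublinear_on_def by blast
  \<comment> \<open>The infimum is finite: t x is the sum of y + t x and -y, so subadditivity bounds
    every member below by -p(-y).\<close>
  have bdd: "bdd_below (f y ` {0..})" if y: "y \<in> carrier X" for y
  proof (rule bdd_belowI2)
    fix t :: real assume "t \<in> {0..}"
    then have "t * p x = p ((y \<oplus> of_real t \<odot> x) \<oplus> \<ominus> y)"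
      using y x sublinear_homogeneous[OF p, of t x]
      by (simp add: M.a_comm[of y] M.a_assoc M.r_neg)
    also have "\<dots> \<le> p (y \<oplus> of_real t \<odot> x) + p (\<ominus> y)"
      using x y by (intro sub) auto
    finally show "- p (\<ominus> y) \<le> f y t" by (simp add: f_def)
  qed
  have q_le: "q y \<le> f y t" if "y \<in> carrier X" "t \<ge> 0" for y t
    unfolding q_def using that bdd by (auto intro: cINF_lower)
  have q_ge: "c \<le> q y" if "y \<in> carrier X" "\<And>t. t \<ge> 0 \<Longrightarrow> c \<le> f y t" for c y
    unfolding q_def using that by (auto intro!: cINF_greatest)
  have "q (v \<oplus> w) \<le> q v + q w" if vw: "v \<in> carrier X" "w \<in> carrier X" for v w
  proof -
    \<comment> \<open>The parameters t and s for the two summands combine to t + s, so the two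
      infima can be taken independently.\<close>
    have *: "q (v \<oplus> w) \<le> f v t + f w s" if "t \<ge> 0" "s \<ge> 0" for t s
    proof -
      have "q (v \<oplus> w) \<le> f (v \<oplus> w) (t + s)"
        using vw that by (intro q_le) auto
      moreover have "(v \<oplus> w) \<oplus> of_real (t + s) \<odot> x = (v \<oplus> of_real t \<odot> x) \<oplus> (w \<oplus> of_real s \<odot> x)"
        using vw x by (simp add: smult_add_scalar M.a_ac)
      ultimately show ?thesis
        using sub[of "v \<oplus> of_real t \<odot> x" "w \<oplus> of_real s \<odot> x"] vw x
        by (simp add: f_def algebra_simps)
    qed
    have "q (v \<oplus> w) - f v t \<le> q w" if "t \<ge> 0" for t
      using *[OF that] vw by (intro q_ge) (auto simp: algebra_simps)
    then have "q (v \<oplus> w) - q w \<le> q v"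
      using vw by (intro q_ge) (auto simp: algebra_simps)
    then show ?thesis by simp
  qed
  moreover have "q (of_real s \<odot> v) \<le> s * q v" if s: "0 \<le> s" and v: "v \<in> carrier X" for s v
  proof (cases "s = 0")
    case True
    have "q (\<zero>) \<le> f \<zero> 0" by (intro q_le) auto
    then show ?thesis using True v x by (simp add: smult_0 f_def sublinear_zero[OF p])
  next
    case False
    \<comment> \<open>Scaling the vector by s rescales the parameter: t for v corresponds to s t for
      s v. Dividing by s is why s = 0 is treated apart.\<close>
    have "q (of_real s \<odot> v) / s \<le> f v t" if t: "t \<ge> 0" for t
    proof -
      have "q (of_real s \<odot> v) \<le> f (of_real s \<odot> v) (s * t)"
        using s t v by (intro q_le) auto
      also have "of_real s \<odot> v \<oplus> of_real (s * t) \<odot> x = of_real s \<odot> (v \<oplus> of_real t \<odot> x)"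
        using v x by (simp add: smult_add_vector smult_smult)
      then have "f (of_real s \<odot> v) (s * t) = s * f v t"
        using s v x sublinear_homogeneous[OF p, of s "v \<oplus> of_real t \<odot> x"]
        by (simp add: f_def algebra_simps)
      finally show ?thesis using False s by (simp add: field_simps)
    qed
    then have "q (of_real s \<odot> v) / s \<le> q v"
      using v by (intro q_ge)
    then show ?thesis using False s by (simp add: field_simps)
  qed
  ultimately have "sublinear_on X q"
    unfolding sublinear_on_def by (simp add: q_def)
  moreover have "q \<le> p"
  proof (rule le_funI)
    fix y show "q y \<le> p y"
    proof (cases "y \<in> carrier X")
      case True
      then show ?thesis using q_le[of y 0] x by (simp add: f_def smult_0)
    qed (use p in \<open>auto simp: q_def sublinear_on_def\<close>)
  qed
  moreover have "q y \<le> p (y \<oplus> x) - p x" if "y \<in> carrier X" for y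
    using q_le[OF that, of 1] x by (simp add: f_def smult_1)
  ultimately show ?thesis by blast
qed

text \<open>The pointwise infimum works. It is finite because p(v) \<ge> -p(-v) \<ge> -p0(-v) for
  every member p. Subadditivity needs the chain condition: two members p and q, one for each
  summand, are both replaced by the smaller of them.\<close>

lemma sublinear_INF:
  assumes C: "C \<noteq> {}" "\<And>p. p \<in> C \<Longrightarrow> sublinear_on X p"
    and p0: "\<And>p. p \<in> C \<Longrightarrow> p \<le> p0"
    and chain: "\<And>p q. p \<in> C \<Longrightarrow> q \<in> C \<Longrightarrow> p \<le> q \<or> q \<le> p"
  shows "\<exists>u. sublinear_on X u \<and> (\<forall>p\<in>C. u \<le> p)"
proof -
  define u where "u v = (if v \<in> carrier X then INF p\<in>C. p v else 0)" for v
  have bdd: "bdd_below ((\<lambda>p. p v) ` C)" if "v \<in> carrier X" for v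
  proof (rule bdd_belowI2)
    fix p assume p: "p \<in> C"
    have "- p0 (\<ominus> v) \<le> - p (\<ominus> v)"
      using p0[OF p] by (simp add: le_fun_def)
    also have "\<dots> \<le> p v"
      using C p that by (intro sublinear_ge)
    finally show "- p0 (\<ominus> v) \<le> p v" .
  qed
  have u_le: "u v \<le> p v" if "v \<in> carrier X" "p \<in> C" for v p
    unfolding u_def using that bdd by (auto intro: cINF_lower)
  have u_ge: "c \<le> u v" if "v \<in> carrier X" "\<And>p. p \<in> C \<Longrightarrow> c \<le> p v" for v c
    unfolding u_def using that C by (auto intro: cINF_greatest)
  have "u (v \<oplus> w) \<le> u v + u w" if vw: "v \<in> carrier X" "w \<in> carrier X" for v w
  proof -
    have *: "u (v \<oplus> w) \<le> p v + q w" if pq: "p \<in> C" "q \<in> C" for p q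
    proof -
      obtain r where r: "r \<in> C" "r \<le> p" "r \<le> q"
        using chain[OF pq] pq by blast
      have "u (v \<oplus> w) \<le> r (v \<oplus> w)" using vw r by (intro u_le) auto
      also have "\<dots> \<le> r v + r w" using C(2)[OF r(1)] vw unfolding sublinear_on_def by blast
      also have "\<dots> \<le> p v + q w" using r by (intro add_mono) (auto simp: le_fun_def)
      finally show ?thesis .
    qed
    have "u (v \<oplus> w) - p v \<le> u w" if "p \<in> C" for p
      using *[OF that] vw by (intro u_ge) (auto simp: algebra_simps)
    then have "u (v \<oplus> w) - u w \<le> u v"
      using vw by (intro u_ge) (auto simp: algebra_simps)
    then show ?thesis by simp
  qed
  moreover have "u (of_real t \<odot> v) \<le> t * u v" if t: "0 \<le> t" and v: "v \<in> carrier X" for t v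
  proof -
    have *: "u (of_real t \<odot> v) \<le> t * p v" if "p \<in> C" for p
      using u_le[OF smult_carrier[OF v] that] sublinear_homogeneous[OF C(2)[OF that] t v] by metis
    show ?thesis
    proof (cases "t = 0")
      case True
      then show ?thesis using * C(1) by auto
    next
      case False
      then have "u (of_real t \<odot> v) / t \<le> u v"
        using * t v by (intro u_ge) (auto simp: field_simps)
      then show ?thesis using False t by (simp add: field_simps)
    qed
  qed
  ultimately have "sublinear_on X u"
    unfolding sublinear_on_def by (simp add: u_def)
  moreover have "u \<le> p" if "p \<in> C" for p
  proof (rule le_funI)
    show "u v \<le> p v" for v
      using u_le[OF _ that] C(2)[OF that] by (cases "v \<in> carrier X") (auto simp: u_def sublinear_on_def)
  qed
  ultimately show ?thesis by blast
qed

text \<open>Zorn's lemma for the reversed pointwise order \<open>?P\<close>, so that a maximal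
  element is a minimal functional. Minimality below p0 is minimality among all sublinear
  functionals, since whatever lies below m lies below p0.\<close>

lemma ex_minimal_sublinear:
  assumes p0: "sublinear_on X p0"
  shows "\<exists>m. sublinear_on X m \<and> m \<le> p0 \<and> (\<forall>q. sublinear_on X q \<longrightarrow> q \<le> m \<longrightarrow> q = m)"
proof -
  let ?A = "{p. sublinear_on X p \<and> p \<le> p0}" and ?P = "\<lambda>p q :: 'a \<Rightarrow> real. q \<le> p"
  have "\<exists>m\<in>?A. \<forall>a\<in>?A. ?P m a \<longrightarrow> a = m"
  proof (rule predicate_Zorn)
    show "partial_order_on ?A (relation_of ?P ?A)"
      by (rule partial_order_on_relation_ofI) auto
    fix C assume C: "C \<in> Chains (relation_of ?P ?A)"
    then have CA: "p \<in> ?A" if "p \<in> C" for p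
      using that unfolding Chains_def relation_of_def by blast
    show "\<exists>u\<in>?A. \<forall>a\<in>C. ?P a u"
    proof (cases "C = {}")
      case True
      then show ?thesis using p0 by blast
    next
      case False
      obtain u where u: "sublinear_on X u" "\<And>p. p \<in> C \<Longrightarrow> u \<le> p"
      proof -
        have "p \<le> q \<or> q \<le> p" if "p \<in> C" "q \<in> C" for p q
          using C that unfolding Chains_def relation_of_def by blast
        moreover have "\<And>p. p \<in> C \<Longrightarrow> sublinear_on X p" "\<And>p. p \<in> C \<Longrightarrow> p \<le> p0"
          using CA by auto
        ultimately have "\<exists>u. sublinear_on X u \<and> (\<forall>p\<in>C. u \<le> p)"
          using False by (intro sublinear_INF[of C p0]) auto
        then show ?thesis using that by blast
      qed
      obtain p where "p \<in> C" using False by blast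
      then have "u \<le> p0" using CA[of p] u(2)[of p] order_trans by blast
      then show ?thesis using u by auto
    qed
  qed
  then obtain m where m: "sublinear_on X m" "m \<le> p0"
    and min: "\<And>q. sublinear_on X q \<Longrightarrow> q \<le> p0 \<Longrightarrow> q \<le> m \<Longrightarrow> q = m"
    by blast
  have "q = m" if "sublinear_on X q" "q \<le> m" for q
    using min[OF that(1) order_trans[OF that(2) m(2)] that(2)] .
  then show ?thesis using m by blast
qed

text \<open>A minimal sublinear functional equals each of its tilts; this forces additivity.\<close>

lemma minimal_sublinear_linear:
  assumes m: "sublinear_on X m" and min: "\<forall>q. sublinear_on X q \<longrightarrow> q \<le> m \<longrightarrow> q = m"
  shows "\<And>v w. v \<in> carrier X \<Longrightarrow> w \<in> carrier X \<Longrightarrow> m (v \<oplus> w) = m v + m w"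
    and "\<And>t v. v \<in> carrier X \<Longrightarrow> m (of_real t \<odot> v) = t * m v"
proof -
  show add: "m (v \<oplus> w) = m v + m w" if "v \<in> carrier X" "w \<in> carrier X" for v w
  proof (rule antisym)
    show "m (v \<oplus> w) \<le> m v + m w"
      using m that unfolding sublinear_on_def by blast
    show "m v + m w \<le> m (v \<oplus> w)"
      using sublinear_tilt[OF m, of w] min that by fastforce
  qed
  fix t v assume v: "v \<in> carrier X"
  show "m (of_real t \<odot> v) = t * m v"
  proof (cases "t \<ge> 0")
    case True
    then show ?thesis using sublinear_homogeneous[OF m _ v] by blast
  next
    case False
    have "m (of_real t \<odot> v \<oplus> of_real (- t) \<odot> v) = 0"
      using v by (simp add: smult_0 sublinear_zero[OF m] flip: smult_add_scalar)
    then have "m (of_real t \<odot> v) + m (of_real (- t) \<odot> v) = 0"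
      using add v smult_carrier by metis
    then show ?thesis
      using False sublinear_homogeneous[OF m _ v, of "- t"] by simp
  qed
qed

text \<open>A minimal functional is taken below the tilt of the norm at x rather than below the norm
  itself. The tilt inequality at y = -x then reads m(-x) \<le> -|x|, and linearity turns this into
  m(x) \<ge> |x|.\<close>

lemma ex_real_norming_functional:
  assumes x: "x \<in> carrier X"
  shows "\<exists>m. (\<forall>v\<in>carrier X. \<forall>w\<in>carrier X. m (v \<oplus> w) = m v + m w) \<and>
    (\<forall>t. \<forall>v\<in>carrier X. m (of_real t \<odot> v) = t * m v) \<and>
    (\<forall>v\<in>carrier X. m v \<le> vnorm X v) \<and> m x = vnorm X x"
proof -
  let ?n = "\<lambda>v. if v \<in> carrier X then vnorm X v else 0"
  have "sublinear_on X ?n"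
    unfolding sublinear_on_def by (auto simp: vnorm_triangle vnorm_smult)
  then obtain q where q: "sublinear_on X q" "q \<le> ?n" "\<And>y. y \<in> carrier X \<Longrightarrow> q y \<le> ?n (y \<oplus> x) - ?n x"
    using sublinear_tilt[of ?n x] x by blast
  obtain m where m: "sublinear_on X m" "m \<le> q" "\<forall>q. sublinear_on X q \<longrightarrow> q \<le> m \<longrightarrow> q = m"
    using ex_minimal_sublinear[OF q(1)] by blast
  note lin = minimal_sublinear_linear[OF m(1,3)]
  have le: "m v \<le> vnorm X v" if "v \<in> carrier X" for v
    using that le_funD[OF m(2), of v] le_funD[OF q(2), of v] by simp
  have "m (\<ominus> x) \<le> - vnorm X x"
    using q(3)[of "\<ominus> x"] le_funD[OF m(2), of "\<ominus> x"] x by (simp add: M.l_neg vnorm_zero)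
  moreover have "m (\<ominus> x) = - m x"
    using lin(2)[OF x, of "-1"] x by (simp add: smult_minus_1)
  ultimately have "m x = vnorm X x" using le[OF x] by simp
  then show ?thesis using lin le by blast
qed

text \<open>Over complex scalars the real-linear m becomes the real part of a complex-linear f, with
  the same bound. Since m(x) is already the norm of x, the bound leaves no room for an imaginary
  part at x.\<close>

theorem ex_norming_functional:
  assumes x: "x \<in> carrier X"
  shows "\<exists>f. f \<in> carrier (dual_space X) \<and> (\<forall>v\<in>carrier X. norm (f v) \<le> vnorm X v) \<and>
    f x = of_real (vnorm X x)"
proof -
  obtain m where m: "\<forall>v\<in>carrier X. \<forall>w\<in>carrier X. m (v \<oplus> w) = m v + m w"
    "\<forall>t. \<forall>v\<in>carrier X. m (of_real t \<odot> v) = t * m v"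
    "\<forall>v\<in>carrier X. m v \<le> vnorm X v" and mx: "m x = vnorm X x"
    using ex_real_norming_functional[OF x] by blast
  have add: "m (v \<oplus> w) = m v + m w" if "v \<in> carrier X" "w \<in> carrier X" for v w
    using m(1) that by blast
  have hom: "m (of_real t \<odot> v) = t * m v" if "v \<in> carrier X" for t v
    using m(2) that by blast
  have le: "m v \<le> vnorm X v" if "v \<in> carrier X" for v
    using m(3) that by blast
  have "\<exists>f :: 'a \<Rightarrow> 'k. (\<forall>v\<in>carrier X. \<forall>w\<in>carrier X. f (v \<oplus> w) = f v + f w) \<and>
     (\<forall>c. \<forall>v\<in>carrier X. f (c \<odot> v) = c * f v) \<and>
     (\<forall>v\<in>carrier X. norm (f v) \<le> vnorm X v) \<and> f x = of_real (vnorm X x)"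
  proof (cases rule: real_or_complex_cases[where 'k='k])
    case real
    have "\<bar>m v\<bar> \<le> vnorm X v" if v: "v \<in> carrier X" for v
      using le[OF v] le[of "\<ominus> v"] hom[OF v, of "-1"] v
      by (simp add: vnorm_uminus smult_minus_1)
    moreover have "of_real (m (c \<odot> v)) = c * of_real (m v)" if "v \<in> carrier X" for c v
      using real[of c] hom[OF that] by auto
    ultimately show ?thesis
      using add mx x vnorm_nonneg by (intro exI[of _ "\<lambda>v. of_real (m v)"]) auto
  next
    case (complex j)
    \<comment> \<open>The only complex-linear functional with real part m: its imaginary part at v
      must be -m(j v).\<close>
    define f where "f v = of_real (m v) + of_real (- m (j \<odot> v)) * j" for v
    have f_add: "f (v \<oplus> w) = f v + f w" if "v \<in> carrier X" "w \<in> carrier X" for v w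
      using that by (simp add: f_def add smult_add_vector algebra_simps)
    have f_real: "f (of_real t \<odot> v) = of_real t * f v" if "v \<in> carrier X" for t v
    proof -
      have "m (j \<odot> (of_real t \<odot> v)) = t * m (j \<odot> v)"
        using that hom[of "j \<odot> v" t] by (simp add: smult_smult mult.commute)
      then show ?thesis using that by (simp add: f_def hom algebra_simps)
    qed
    have f_j: "f (j \<odot> v) = j * f v" if v: "v \<in> carrier X" for v
    proof -
      have "m (j \<odot> (j \<odot> v)) = - m v"
        using v hom[OF v, of "-1"] by (simp add: smult_smult complex(1))
      then show ?thesis
        by (simp add: f_def complex(1) algebra_simps flip: mult.assoc)
    qed
    have f_smult: "f (c \<odot> v) = c * f v" if v: "v \<in> carrier X" for c v
    proof -
      obtain a b where c: "c = of_real a + of_real b * j" using complex(2) by blast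
      have "c \<odot> v = of_real a \<odot> v \<oplus> of_real b \<odot> (j \<odot> v)"
        using v by (simp add: c smult_add_scalar smult_smult)
      then show ?thesis
        using v by (simp add: f_add f_real f_j) (simp add: c algebra_simps)
    qed
    have f_le: "norm (f v) \<le> vnorm X v" if v: "v \<in> carrier X" for v
    proof (cases "f v = 0")
      case True
      then show ?thesis using v by (simp add: vnorm_nonneg)
    next
      case False
      \<comment> \<open>A unimodular factor that makes f(\<theta> v) real and equal to |f(v)|, so
        that the bound on the real part m applies.\<close>
      define \<theta> where "\<theta> = of_real (norm (f v)) / f v"
      have \<theta>: "norm \<theta> = 1" using False by (simp add: \<theta>_def norm_divide)
      have f\<theta>: "f (\<theta> \<odot> v) = of_real (norm (f v))"
        using v False by (simp add: f_smult \<theta>_def)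
      \<comment> \<open>Real and imaginary part of f(\<theta> v) - |f(v)|; both vanish by the norm
        formula, and a = 0 says m(\<theta> v) = |f(v)|.\<close>
      define a b where "a = m (\<theta> \<odot> v) - norm (f v)" and "b = - m (j \<odot> (\<theta> \<odot> v))"
      have "of_real a + of_real b * j = 0"
        using f\<theta> unfolding f_def[of "\<theta> \<odot> v"] by (simp add: a_def b_def algebra_simps)
      then have "sqrt (a\<^sup>2 + b\<^sup>2) = 0"
        using complex(3)[of a b] by simp
      then have "m (\<theta> \<odot> v) = norm (f v)"
        by (simp add: a_def sum_power2_eq_zero_iff)
      then show ?thesis
        using le[of "\<theta> \<odot> v"] v \<theta> by (simp add: vnorm_smult)
    qed
    \<comment> \<open>The squared bound |f(x)| \<le> |x| with |x| = m(x): it forces m(j x) =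
      0.\<close>
    have "(m x)\<^sup>2 + (m (j \<odot> x))\<^sup>2 \<le> (m x)\<^sup>2"
      using f_le[OF x] vnorm_nonneg[OF x] by (simp add: f_def complex(3) real_sqrt_le_iff' mx del: of_real_minus)
    then have "f x = of_real (vnorm X x)"
      by (simp add: f_def mx)
    then show ?thesis using f_add f_smult f_le by blast
  qed
  then obtain f :: "'a \<Rightarrow> 'k" where f: "\<forall>v\<in>carrier X. \<forall>w\<in>carrier X. f (v \<oplus> w) = f v + f w"
    "\<forall>c. \<forall>v\<in>carrier X. f (c \<odot> v) = c * f v"
    "\<forall>v\<in>carrier X. norm (f v) \<le> vnorm X v" "f x = of_real (vnorm X x)"
    by blast
  have "(\<exists>C. \<forall>v\<in>carrier X. norm (f v) \<le> C * vnorm X v)"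
    using f(3) by (intro exI[of _ 1]) simp
  then have "restrict f (carrier X) \<in> carrier (dual_space X)"
    using f unfolding dual_space_def by simp
  then show ?thesis
    using f(3,4) x by (intro exI[of _ "restrict f (carrier X)"]) simp
qed

end

section \<open>Bounded multilinear maps\<close>

abbreviation tuples :: "nat \<Rightarrow> (nat \<Rightarrow> ('k, 'a) normed_space) \<Rightarrow> (nat \<Rightarrow> 'a) set" where
  "tuples N X \<equiv> \<Pi>\<^sub>E i\<in>{1..N}. carrier (X i)"

lemma PiE_upd:
  "x \<in> Pi\<^sub>E I F \<Longrightarrow> i \<in> I \<Longrightarrow> v \<in> F i \<Longrightarrow> x(i := v) \<in> Pi\<^sub>E I F"
  by (auto simp: PiE_iff extensional_def)

lemma unit_sphereD: "v \<in> unit_sphere X \<Longrightarrow> v \<in> carrier X" "v \<in> unit_sphere X \<Longrightarrow> vnorm X v = 1"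
  by (simp_all add: unit_sphere_def)

lemma spheresD: "x \<in> spheres N X \<Longrightarrow> i \<in> {1..N} \<Longrightarrow> x i \<in> unit_sphere (X i)"
  by (auto simp: spheres_def)

lemma spheres_tuples: "x \<in> spheres N X \<Longrightarrow> x \<in> tuples N X"
  by (auto simp: spheres_def unit_sphere_def PiE_iff)

lemma spheres_upd:
  "x \<in> spheres N X \<Longrightarrow> i \<in> {1..N} \<Longrightarrow> v \<in> unit_sphere (X i) \<Longrightarrow> x(i := v) \<in> spheres N X"
  unfolding spheres_def by (rule PiE_upd)

lemma bounded_multilinear_mapsI:
  assumes "A \<in> tuples N X \<rightarrow>\<^sub>E carrier Y"
    and "\<And>x i v w. x \<in> tuples N X \<Longrightarrow> i \<in> {1..N} \<Longrightarrow> v \<in> carrier (X i) \<Longrightarrow> w \<in> carrier (X i) \<Longrightarrow>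
      A (x(i := v \<oplus>\<^bsub>X i\<^esub> w)) = A (x(i := v)) \<oplus>\<^bsub>Y\<^esub> A (x(i := w))"
    and "\<And>x i c v. x \<in> tuples N X \<Longrightarrow> i \<in> {1..N} \<Longrightarrow> v \<in> carrier (X i) \<Longrightarrow>
      A (x(i := c \<odot>\<^bsub>X i\<^esub> v)) = c \<odot>\<^bsub>Y\<^esub> A (x(i := v))"
    and "\<And>x. x \<in> tuples N X \<Longrightarrow> vnorm Y (A x) \<le> C * (\<Prod>i=1..N. vnorm (X i) (x i))"
  shows "A \<in> bounded_multilinear_maps N X Y"
  unfolding bounded_multilinear_maps_def multilinear_maps_def
  by (intro CollectI conjI ballI allI exI[of _ C] assms(1)) (rule assms; assumption)+

lemma
  assumes A: "A \<in> bounded_multilinear_maps N X Y"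
  shows bounded_multilinear_ext: "A \<in> tuples N X \<rightarrow>\<^sub>E carrier Y"
    and bounded_multilinear_closed: "x \<in> tuples N X \<Longrightarrow> A x \<in> carrier Y"
    and bounded_multilinear_add:
      "x \<in> tuples N X \<Longrightarrow> i \<in> {1..N} \<Longrightarrow> v \<in> carrier (X i) \<Longrightarrow> w \<in> carrier (X i) \<Longrightarrow>
       A (x(i := v \<oplus>\<^bsub>X i\<^esub> w)) = A (x(i := v)) \<oplus>\<^bsub>Y\<^esub> A (x(i := w))"
    and bounded_multilinear_smult:
      "x \<in> tuples N X \<Longrightarrow> i \<in> {1..N} \<Longrightarrow> v \<in> carrier (X i) \<Longrightarrow>
       A (x(i := c \<odot>\<^bsub>X i\<^esub> v)) = c \<odot>\<^bsub>Y\<^esub> A (x(i := v))"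
    and bounded_multilinear_bound:
      "\<exists>C. \<forall>x\<in>tuples N X. vnorm Y (A x) \<le> C * (\<Prod>i=1..N. vnorm (X i) (x i))"
proof -
  show ext: "A \<in> tuples N X \<rightarrow>\<^sub>E carrier Y"
    using A unfolding bounded_multilinear_maps_def multilinear_maps_def by blast
  show "x \<in> tuples N X \<Longrightarrow> A x \<in> carrier Y"
    using ext by (rule PiE_mem)
qed (use A in \<open>unfold bounded_multilinear_maps_def multilinear_maps_def, blast+\<close>)

section \<open>Operator norm and distances as suprema and maxima\<close>

lemma bdd_above_spheres:
  assumes "A \<in> bounded_multilinear_maps N X Y"
  shows "bdd_above ((\<lambda>x. vnorm Y (A x)) ` spheres N X)"
proof -
  obtain C where C: "\<forall>x\<in>tuples N X. vnorm Y (A x) \<le> C * (\<Prod>i=1..N. vnorm (X i) (x i))"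
    using bounded_multilinear_bound[OF assms] by blast
  show ?thesis
  proof (rule bdd_aboveI2)
    fix x assume x: "x \<in> spheres N X"
    have "(\<Prod>i=1..N. vnorm (X i) (x i)) = 1"
      using spheresD[OF x] by (intro prod.neutral) (simp add: unit_sphere_def)
    then show "vnorm Y (A x) \<le> C"
      using C spheres_tuples[OF x] by force
  qed
qed

text \<open>Boundedness on the spheres is taken as the hypothesis so that the lemma also applies to
  differences \<open>map_diff\<close>, whose multilinearity is never established.\<close>

lemma opnorm_upper_bdd:
  "bdd_above ((\<lambda>x. vnorm Y (A x)) ` spheres N X) \<Longrightarrow> x \<in> spheres N X \<Longrightarrow>
   vnorm Y (A x) \<le> opnorm N X Y A"
  unfolding opnorm_def by (rule cSUP_upper)

lemma opnorm_upper:
  "A \<in> bounded_multilinear_maps N X Y \<Longrightarrow> x \<in> spheres N X \<Longrightarrow> vnorm Y (A x) \<le> opnorm N X Y A"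
  by (rule opnorm_upper_bdd[OF bdd_above_spheres])

lemma opnorm_least:
  "spheres N X \<noteq> {} \<Longrightarrow> (\<And>x. x \<in> spheres N X \<Longrightarrow> vnorm Y (A x) \<le> c) \<Longrightarrow> opnorm N X Y A \<le> c"
  unfolding opnorm_def by (rule cSUP_least)

lemma opnorm_cong:
  "(\<And>x. x \<in> spheres N X \<Longrightarrow> vnorm Y (A x) = vnorm Z (B x)) \<Longrightarrow> opnorm N X Y A = opnorm N X Z B"
  unfolding opnorm_def by (auto intro: SUP_cong)

lemma opnorm_eq_1I:
  assumes "A \<in> bounded_multilinear_maps N X Y"
    and "\<And>x. x \<in> spheres N X \<Longrightarrow> vnorm Y (A x) \<le> 1"
    and "x \<in> spheres N X" "vnorm Y (A x) = 1"
  shows "opnorm N X Y A = 1"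
  using opnorm_upper[OF assms(1,3)] opnorm_least[of N X Y A 1] assms by fastforce

text \<open>The triangle inequality for differences enters as a hypothesis, so that one lemma serves
  Banach spaces and \<open>scalar_space\<close>; the latter is known to be a
  \<open>banach_space\<close> only for scalar types of class \<open>banach\<close>.\<close>

lemma bdd_above_map_diff:
  assumes A: "A \<in> bounded_multilinear_maps N X Y" and B: "B \<in> bounded_multilinear_maps N X Y"
    and Y: "\<And>v w. v \<in> carrier Y \<Longrightarrow> w \<in> carrier Y \<Longrightarrow> vnorm Y (v \<ominus>\<^bsub>Y\<^esub> w) \<le> vnorm Y v + vnorm Y w"
  shows "bdd_above ((\<lambda>x. vnorm Y (map_diff N X Y B A x)) ` spheres N X)"
proof (rule bdd_aboveI2)
  fix x assume x: "x \<in> spheres N X"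
  note t = spheres_tuples[OF x]
  have "vnorm Y (map_diff N X Y B A x) \<le> vnorm Y (B x) + vnorm Y (A x)"
    using t Y[OF bounded_multilinear_closed[OF B t] bounded_multilinear_closed[OF A t]]
    by (simp add: map_diff_def)
  also have "\<dots> \<le> opnorm N X Y B + opnorm N X Y A"
    using opnorm_upper[OF A x] opnorm_upper[OF B x] by simp
  finally show "vnorm Y (map_diff N X Y B A x) \<le> opnorm N X Y B + opnorm N X Y A" .
qed

lemma norm_diff_le_opnorm_scalar:
  fixes A B :: "(nat \<Rightarrow> 'a) \<Rightarrow> 'k::real_or_complex"
  assumes "A \<in> bounded_multilinear_maps N X scalar_space"
    and "B \<in> bounded_multilinear_maps N X scalar_space" and x: "x \<in> spheres N X"
  shows "norm (B x - A x) \<le> opnorm N X scalar_space (map_diff N X scalar_space B A)"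
proof -
  have "map_diff N X scalar_space B A x = B x - A x"
    using spheres_tuples[OF x] by (simp add: map_diff_def)
  then show ?thesis
    using opnorm_upper_bdd[OF bdd_above_map_diff[OF assms(1,2)] x] by (simp add: norm_triangle_ineq4)
qed

lemma tuple_dist_upper:
  "j \<in> {1..N} \<Longrightarrow> vnorm (X j) (x j \<ominus>\<^bsub>X j\<^esub> z j) \<le> tuple_dist N X x z"
  unfolding tuple_dist_def by (rule Max_ge) auto

text \<open>The hypothesis \<open>1 \<le> N\<close> makes the set under \<open>Max\<close>
  nonempty.\<close>

lemma tuple_dist_least:
  "1 \<le> N \<Longrightarrow> (\<And>j. j \<in> {1..N} \<Longrightarrow> vnorm (X j) (x j \<ominus>\<^bsub>X j\<^esub> z j) \<le> c) \<Longrightarrow> tuple_dist N X x z \<le> c"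
  unfolding tuple_dist_def by (subst Max_le_iff) auto

locale banach_family =
  fixes N :: nat and X :: "nat \<Rightarrow> ('k::real_or_complex, 'a) normed_space"
  assumes banach: "i \<in> {1..N} \<Longrightarrow> banach_space (X i)"
    and nonzero: "i \<in> {1..N} \<Longrightarrow> carrier (X i) \<noteq> {\<zero>\<^bsub>X i\<^esub>}"

lemma (in banach_space) normalize:
  assumes "v \<in> carrier X" "v \<noteq> \<zero>"
  shows "of_real (1 / vnorm X v) \<odot> v \<in> unit_sphere X"
  using assms by (simp add: unit_sphere_def vnorm_smult vnorm_eq_0_iff vnorm_nonneg norm_divide)

lemma (in banach_space) unit_sphere_nonempty:
  "carrier X \<noteq> {\<zero>} \<Longrightarrow> unit_sphere X \<noteq> {}"
  using normalize M.zero_closed by blast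

lemma (in banach_family) spheres_nonempty: "spheres N X \<noteq> {}"
  unfolding spheres_def PiE_eq_empty_iff
  using banach nonzero banach_space.unit_sphere_nonempty by blast

section \<open>Functionals\<close>

lemma carrier_dual_spaceI:
  assumes "f \<in> extensional (carrier X)"
    and "\<And>v w. v \<in> carrier X \<Longrightarrow> w \<in> carrier X \<Longrightarrow> f (v \<oplus>\<^bsub>X\<^esub> w) = f v + f w"
    and "\<And>c v. v \<in> carrier X \<Longrightarrow> f (c \<odot>\<^bsub>X\<^esub> v) = c * f v"
    and "\<And>v. v \<in> carrier X \<Longrightarrow> norm (f v) \<le> C * vnorm X v"
  shows "f \<in> carrier (dual_space X)"
proof -
  have "\<exists>C. \<forall>v\<in>carrier X. norm (f v) \<le> C * vnorm X v"
    using assms(4) by blast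
  then show ?thesis
    using assms(1-3) unfolding dual_space_def by (simp add: PiE_iff)
qed

lemma
  assumes "f \<in> carrier (dual_space X)"
  shows dual_ext: "f \<in> extensional (carrier X)"
    and dual_add: "v \<in> carrier X \<Longrightarrow> w \<in> carrier X \<Longrightarrow> f (v \<oplus>\<^bsub>X\<^esub> w) = f v + f w"
    and dual_smult: "v \<in> carrier X \<Longrightarrow> f (c \<odot>\<^bsub>X\<^esub> v) = c * f v"
    and dual_bound: "\<exists>C. \<forall>v\<in>carrier X. norm (f v) \<le> C * vnorm X v"
  using assms unfolding dual_space_def by (auto simp: PiE_iff)

lemma add_dual_space [simp]: "f \<oplus>\<^bsub>dual_space X\<^esub> g = (\<lambda>v\<in>carrier X. f v + g v)"
  and smult_dual_space [simp]: "c \<odot>\<^bsub>dual_space X\<^esub> f = (\<lambda>v\<in>carrier X. c * f v)"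
  and zero_dual_space [simp]: "\<zero>\<^bsub>dual_space X\<^esub> = (\<lambda>v\<in>carrier X. 0)"
  by (simp_all add: dual_space_def)

lemma vnorm_dual_space: "vnorm (dual_space X) f = (SUP v\<in>unit_sphere X. norm (f v))"
  by (simp add: dual_space_def)

lemma bdd_above_dual:
  assumes "f \<in> carrier (dual_space X)"
  shows "bdd_above ((\<lambda>v. norm (f v)) ` unit_sphere X)"
proof -
  obtain C where "\<forall>v\<in>carrier X. norm (f v) \<le> C * vnorm X v"
    using dual_bound[OF assms] by blast
  then show ?thesis
    by (intro bdd_aboveI2[where M = C]) (force simp: unit_sphere_def)
qed

lemma norm_le_dual_norm:
  "f \<in> carrier (dual_space X) \<Longrightarrow> v \<in> unit_sphere X \<Longrightarrow> norm (f v) \<le> vnorm (dual_space X) f"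
  unfolding vnorm_dual_space by (rule cSUP_upper[OF _ bdd_above_dual])

lemma dual_norm_least:
  "unit_sphere X \<noteq> {} \<Longrightarrow> (\<And>v. v \<in> unit_sphere X \<Longrightarrow> norm (f v) \<le> c) \<Longrightarrow> vnorm (dual_space X) f \<le> c"
  unfolding vnorm_dual_space by (rule cSUP_least)

text \<open>The dual norm is a supremum over the unit sphere; rescaling carries the estimate to
  nonzero vectors, and at zero both sides vanish.\<close>

lemma (in banach_space) dual_norm_bound:
  assumes f: "f \<in> carrier (dual_space X)" and v: "v \<in> carrier X"
  shows "norm (f v) \<le> vnorm (dual_space X) f * vnorm X v"
proof (cases "v = \<zero>")
  case True
  then show ?thesis
    using dual_smult[OF f v, of 0] v by (simp add: smult_0 vnorm_zero)
next
  case False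
  then have pos: "vnorm X v > 0"
    using v vnorm_nonneg[of v] vnorm_eq_0_iff[of v] by simp
  have "norm (f (of_real (1 / vnorm X v) \<odot> v)) \<le> vnorm (dual_space X) f"
    using f False v normalize by (intro norm_le_dual_norm)
  then have "norm (f v) / vnorm X v \<le> vnorm (dual_space X) f"
    using pos unfolding dual_smult[OF f v] by (simp add: norm_divide norm_mult)
  then show ?thesis
    using pos by (simp add: pos_divide_le_eq)
qed

text \<open>The group laws serve to evaluate \<open>\<ominus>\<close> in the dual pointwise, as
  distances between maps into the dual require.\<close>

lemma (in banach_space) abelian_group_dual_space: "abelian_group (dual_space X)"
proof (rule abelian_groupI)
  fix f g :: "'a \<Rightarrow> 'k" assume f: "f \<in> carrier (dual_space X)" and g: "g \<in> carrier (dual_space X)"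
  obtain C D where CD: "\<forall>v\<in>carrier X. norm (f v) \<le> C * vnorm X v"
    "\<forall>v\<in>carrier X. norm (g v) \<le> D * vnorm X v"
    using dual_bound[OF f] dual_bound[OF g] by blast
  have "norm (f v + g v) \<le> (C + D) * vnorm X v" if "v \<in> carrier X" for v
    using norm_triangle_ineq[of "f v" "g v"] CD that by (fastforce simp: algebra_simps)
  then show "f \<oplus>\<^bsub>dual_space X\<^esub> g \<in> carrier (dual_space X)"
    by (intro carrier_dual_spaceI[where C = "C + D"])
      (auto simp: dual_add[OF f] dual_add[OF g] dual_smult[OF f] dual_smult[OF g] algebra_simps)
next
  show "\<zero>\<^bsub>dual_space X\<^esub> \<in> carrier (dual_space X)"
    by (intro carrier_dual_spaceI[where C = 0]) auto
next
  fix f assume f: "f \<in> carrier (dual_space X)"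
  show "\<zero>\<^bsub>dual_space X\<^esub> \<oplus>\<^bsub>dual_space X\<^esub> f = f"
    using dual_ext[OF f] by (auto simp: fun_eq_iff extensional_def)
  obtain C where "\<forall>v\<in>carrier X. norm (f v) \<le> C * vnorm X v"
    using dual_bound[OF f] by blast
  then have "(\<lambda>v\<in>carrier X. - f v) \<in> carrier (dual_space X)"
    by (intro carrier_dual_spaceI[where C = C]) (auto simp: dual_add[OF f] dual_smult[OF f])
  then show "\<exists>g\<in>carrier (dual_space X). g \<oplus>\<^bsub>dual_space X\<^esub> f = \<zero>\<^bsub>dual_space X\<^esub>"
    by (rule bexI[rotated]) (auto simp: fun_eq_iff)
qed (auto simp: fun_eq_iff)

lemma (in banach_space) minus_dual_space:
  assumes f: "f \<in> carrier (dual_space X)" and g: "g \<in> carrier (dual_space X)"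
  shows "f \<ominus>\<^bsub>dual_space X\<^esub> g = (\<lambda>v\<in>carrier X. f v - g v)"
proof -
  interpret D: abelian_group "dual_space X" by (rule abelian_group_dual_space)
  have "\<ominus>\<^bsub>dual_space X\<^esub> g \<oplus>\<^bsub>dual_space X\<^esub> g = \<zero>\<^bsub>dual_space X\<^esub>"
    using g by (rule D.l_neg)
  then have "(\<ominus>\<^bsub>dual_space X\<^esub> g) v = - g v" if "v \<in> carrier X" for v
    using that by (auto simp: fun_eq_iff restrict_def add_eq_0_iff2 split: if_splits)
  then show ?thesis
    by (auto simp: a_minus_def fun_eq_iff)
qed

lemma slice_in_dual:
  fixes B :: "(nat \<Rightarrow> 'a) \<Rightarrow> 'k::real_or_complex"
  assumes B: "B \<in> bounded_multilinear_maps N X scalar_space"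
    and Xi: "banach_space (X i)" and x: "x \<in> tuples N X" and i: "i \<in> {1..N}"
  shows "(\<lambda>v\<in>carrier (X i). B (x(i := v))) \<in> carrier (dual_space (X i))"
proof -
  obtain C where C: "\<forall>x\<in>tuples N X. norm (B x) \<le> C * (\<Prod>i=1..N. vnorm (X i) (x i))"
    using bounded_multilinear_bound[OF B] by auto
  define D where "D = C * (\<Prod>j\<in>{1..N} - {i}. vnorm (X j) (x j))"
  have bound: "norm (B (x(i := v))) \<le> D * vnorm (X i) v" if v: "v \<in> carrier (X i)" for v
  proof -
    have "(\<Prod>j=1..N. vnorm (X j) ((x(i := v)) j)) =
        vnorm (X i) v * (\<Prod>j\<in>{1..N} - {i}. vnorm (X j) (x j))"
      using i by (subst prod.remove[of _ i]) (auto intro!: prod.cong)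
    then show ?thesis
      using C[rule_format, OF PiE_upd[OF x i v]] by (simp add: D_def mult_ac)
  qed
  interpret Xi: banach_space "X i" by fact
  show ?thesis
    using i bounded_multilinear_add[OF B x i] bounded_multilinear_smult[OF B x i]
    by (intro carrier_dual_spaceI[where C = D]) (auto simp: bound)
qed

text \<open>The elementary tensor of the functionals \<open>g j\<close>. For \<open>N = 1\<close> it
  turns a functional on vectors into a 1-linear map, whose argument is a tuple of length
  one.\<close>

definition product_map ::
  "nat \<Rightarrow> (nat \<Rightarrow> ('k::real_or_complex, 'a) normed_space) \<Rightarrow> (nat \<Rightarrow> 'a \<Rightarrow> 'k) \<Rightarrow> (nat \<Rightarrow> 'a) \<Rightarrow> 'k"
  where "product_map N X g = (\<lambda>x\<in>tuples N X. \<Prod>j=1..N. g j (x j))"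

lemma prod_upd:
  assumes "i \<in> I" "finite I"
  shows "(\<Prod>j\<in>I. g j ((x(i := v)) j)) = g i v * (\<Prod>j\<in>I - {i}. g j (x j) :: 'k::comm_monoid_mult)"
  using assms by (subst prod.remove[of _ i]) (auto intro!: prod.cong)

lemma (in banach_family) product_map_bounded:
  assumes g: "\<And>j. j \<in> {1..N} \<Longrightarrow> g j \<in> carrier (dual_space (X j))"
  shows "product_map N X g \<in> bounded_multilinear_maps N X scalar_space"
proof -
  have "\<exists>C. \<forall>v\<in>carrier (X j). norm (g j v) \<le> C * vnorm (X j) v" if "j \<in> {1..N}" for j
    using dual_bound[OF g[OF that]] .
  then obtain C where C: "\<And>j v. j \<in> {1..N} \<Longrightarrow> v \<in> carrier (X j) \<Longrightarrow> norm (g j v) \<le> C j * vnorm (X j) v"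
    by metis
  show ?thesis
  proof (rule bounded_multilinear_mapsI[where C = "\<Prod>j=1..N. C j"])
    fix x i v w assume x: "x \<in> tuples N X" and i: "i \<in> {1..N}"
      and v: "v \<in> carrier (X i)" and w: "w \<in> carrier (X i)"
    interpret Xi: banach_space "X i" by (rule banach[OF i])
    have "x(i := v \<oplus>\<^bsub>X i\<^esub> w) \<in> tuples N X" "x(i := v) \<in> tuples N X" "x(i := w) \<in> tuples N X"
      by (rule PiE_upd[OF x i], simp add: v w)+
    then show "product_map N X g (x(i := v \<oplus>\<^bsub>X i\<^esub> w)) =
      product_map N X g (x(i := v)) \<oplus>\<^bsub>scalar_space\<^esub> product_map N X g (x(i := w))"
      using i dual_add[OF g[OF i] v w]
      by (simp add: product_map_def prod_upd distrib_right del: fun_upd_apply)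
  next
    fix x i c v assume x: "x \<in> tuples N X" and i: "i \<in> {1..N}" and v: "v \<in> carrier (X i)"
    interpret Xi: banach_space "X i" by (rule banach[OF i])
    have "x(i := c \<odot>\<^bsub>X i\<^esub> v) \<in> tuples N X" "x(i := v) \<in> tuples N X"
      by (rule PiE_upd[OF x i], simp add: v)+
    then show "product_map N X g (x(i := c \<odot>\<^bsub>X i\<^esub> v)) = c \<odot>\<^bsub>scalar_space\<^esub> product_map N X g (x(i := v))"
      using i dual_smult[OF g[OF i] v]
      by (simp add: product_map_def prod_upd mult.assoc del: fun_upd_apply)
  next
    fix x assume x: "x \<in> tuples N X"
    have "(\<Prod>j=1..N. norm (g j (x j))) \<le> (\<Prod>j=1..N. C j * vnorm (X j) (x j))"
      using C PiE_mem[OF x] by (intro prod_mono) auto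
    then show "vnorm scalar_space (product_map N X g x) \<le>
      (\<Prod>j=1..N. C j) * (\<Prod>i=1..N. vnorm (X i) (x i))"
      using x by (simp add: product_map_def prod.distrib flip: prod_norm)
  qed (simp add: product_map_def)
qed

section \<open>Transfer of the properties\<close>

text \<open>A near-attaining point x for A goes to x' for A', the property yields z', and z' comes
  back to z without increasing the distance, so \<epsilon> and \<eta> pass unchanged. A' is fixed
  before \<eta> and x because \<open>Loo\<close> takes \<eta> from the map; x' may depend on
  everything.\<close>

lemma op_transfer:
  fixes X :: "nat \<Rightarrow> ('k::real_or_complex, 'a) normed_space" and Y :: "('k, 'b) normed_space"
    and X' :: "nat \<Rightarrow> ('k, 'c) normed_space" and Y' :: "('k, 'd) normed_space"
  assumes transfer: "\<And>A. A \<in> bounded_multilinear_maps N X Y \<Longrightarrow> opnorm N X Y A = 1 \<Longrightarrow>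
      \<exists>A'\<in>bounded_multilinear_maps N' X' Y'. opnorm N' X' Y' A' = 1 \<and>
        (\<forall>\<eta>. \<forall>x\<in>spheres N X. vnorm Y (A x) > 1 - \<eta> \<longrightarrow>
          (\<exists>x'\<in>spheres N' X'. vnorm Y' (A' x') > 1 - \<eta> \<and>
            (\<forall>z'\<in>spheres N' X'. vnorm Y' (A' z') = 1 \<longrightarrow>
              (\<exists>z\<in>spheres N X. vnorm Y (A z) = 1 \<and> tuple_dist N X x z \<le> tuple_dist N' X' x' z'))))"
    and P: "P = BPBop \<or> P = Loo" and hP: "has_property P N' X' Y'"
  shows "has_property P N X Y"
  using P
proof
  assume P: "P = BPBop"
  show ?thesis
    unfolding P has_property.simps has_BPBop_def
  proof (intro allI impI)
    fix \<epsilon> :: real assume "\<epsilon> > 0"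
    then obtain \<eta> where \<eta>: "\<eta> > 0" and op: "\<And>A' x'. A' \<in> bounded_multilinear_maps N' X' Y' \<Longrightarrow>
        x' \<in> spheres N' X' \<Longrightarrow> opnorm N' X' Y' A' = 1 \<Longrightarrow> vnorm Y' (A' x') > 1 - \<eta> \<Longrightarrow>
        \<exists>z'\<in>spheres N' X'. vnorm Y' (A' z') = 1 \<and> tuple_dist N' X' x' z' < \<epsilon>"
      using hP unfolding P has_property.simps has_BPBop_def by meson
    show "\<exists>\<eta>>0. \<forall>A\<in>bounded_multilinear_maps N X Y. \<forall>x\<in>spheres N X.
        opnorm N X Y A = 1 \<longrightarrow> vnorm Y (A x) > 1 - \<eta> \<longrightarrow>
        (\<exists>z\<in>spheres N X. vnorm Y (A z) = 1 \<and> tuple_dist N X x z < \<epsilon>)"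
    proof (intro exI[of _ \<eta>] conjI \<eta> ballI impI)
      fix A x assume A: "A \<in> bounded_multilinear_maps N X Y" "opnorm N X Y A = 1"
        and x: "x \<in> spheres N X" "vnorm Y (A x) > 1 - \<eta>"
      obtain A' x' where A': "A' \<in> bounded_multilinear_maps N' X' Y'" "opnorm N' X' Y' A' = 1"
        and x': "x' \<in> spheres N' X'" "vnorm Y' (A' x') > 1 - \<eta>"
        and z: "\<And>z'. z' \<in> spheres N' X' \<Longrightarrow> vnorm Y' (A' z') = 1 \<Longrightarrow>
          \<exists>z\<in>spheres N X. vnorm Y (A z) = 1 \<and> tuple_dist N X x z \<le> tuple_dist N' X' x' z'"
        using transfer[OF A] x by meson
      show "\<exists>z\<in>spheres N X. vnorm Y (A z) = 1 \<and> tuple_dist N X x z < \<epsilon>"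
      proof -
        obtain z' where z': "z' \<in> spheres N' X'" "vnorm Y' (A' z') = 1" "tuple_dist N' X' x' z' < \<epsilon>"
          using op[OF A'(1) x'(1) A'(2) x'(2)] by blast
        then show ?thesis using z[OF z'(1,2)] by force
      qed
    qed
  qed
next
  assume P: "P = Loo"
  show ?thesis
    unfolding P has_property.simps has_Loo_def
  proof (intro allI ballI impI)
    fix \<epsilon> :: real and A
    assume \<epsilon>: "\<epsilon> > 0" and A: "A \<in> bounded_multilinear_maps N X Y" "opnorm N X Y A = 1"
    obtain A' where A': "A' \<in> bounded_multilinear_maps N' X' Y'" "opnorm N' X' Y' A' = 1"
      and tr: "\<forall>\<eta>. \<forall>x\<in>spheres N X. vnorm Y (A x) > 1 - \<eta> \<longrightarrow>
          (\<exists>x'\<in>spheres N' X'. vnorm Y' (A' x') > 1 - \<eta> \<and>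
            (\<forall>z'\<in>spheres N' X'. vnorm Y' (A' z') = 1 \<longrightarrow>
              (\<exists>z\<in>spheres N X. vnorm Y (A z) = 1 \<and> tuple_dist N X x z \<le> tuple_dist N' X' x' z')))"
      using transfer[OF A] by (elim bexE conjE) (rule that)
    obtain \<eta> where \<eta>: "\<eta> > 0" and op: "\<And>x'. x' \<in> spheres N' X' \<Longrightarrow> vnorm Y' (A' x') > 1 - \<eta> \<Longrightarrow>
        \<exists>z'\<in>spheres N' X'. vnorm Y' (A' z') = 1 \<and> tuple_dist N' X' x' z' < \<epsilon>"
      using hP[unfolded P has_property.simps has_Loo_def, rule_format, OF \<epsilon> A'] by (elim exE conjE) (rule that; blast)
    show "\<exists>\<eta>>0. \<forall>x\<in>spheres N X. vnorm Y (A x) > 1 - \<eta> \<longrightarrow>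
        (\<exists>z\<in>spheres N X. vnorm Y (A z) = 1 \<and> tuple_dist N X x z < \<epsilon>)"
    proof (intro exI[of _ \<eta>] conjI \<eta> ballI impI)
      fix x assume x: "x \<in> spheres N X" "vnorm Y (A x) > 1 - \<eta>"
      show "\<exists>z\<in>spheres N X. vnorm Y (A z) = 1 \<and> tuple_dist N X x z < \<epsilon>"
      proof -
        obtain x' where x': "x' \<in> spheres N' X'" "vnorm Y' (A' x') > 1 - \<eta>"
          and z: "\<And>z'. z' \<in> spheres N' X' \<Longrightarrow> vnorm Y' (A' z') = 1 \<Longrightarrow>
            \<exists>z\<in>spheres N X. vnorm Y (A z) = 1 \<and> tuple_dist N X x z \<le> tuple_dist N' X' x' z'"
          using tr[rule_format, OF x] by blast
        obtain z' where z': "z' \<in> spheres N' X'" "vnorm Y' (A' z') = 1" "tuple_dist N' X' x' z' < \<epsilon>"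
          using op[OF x'] by blast
        then show ?thesis using z[OF z'(1,2)] by force
      qed
    qed
  qed
qed

text \<open>The common core of the two p-properties, which then differ only in whether \<eta> is
  chosen before or after x.\<close>

definition point_property ::
  "nat \<Rightarrow> (nat \<Rightarrow> ('k::real_or_complex, 'a) normed_space) \<Rightarrow> ('k, 'b) normed_space \<Rightarrow>
     real \<Rightarrow> real \<Rightarrow> (nat \<Rightarrow> 'a) \<Rightarrow> bool" where
  "point_property N X Y \<epsilon> \<eta> x \<longleftrightarrow> (\<forall>A\<in>bounded_multilinear_maps N X Y.
     opnorm N X Y A = 1 \<longrightarrow> vnorm Y (A x) > 1 - \<eta> \<longrightarrow>
     (\<exists>B\<in>bounded_multilinear_maps N X Y.
        opnorm N X Y B = 1 \<and> vnorm Y (B x) = 1 \<and> opnorm N X Y (map_diff N X Y B A) < \<epsilon>))"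

lemma has_BPBpp_iff:
  "has_BPBpp N X Y \<longleftrightarrow> (\<forall>\<epsilon>>0. \<exists>\<eta>>0. \<forall>x\<in>spheres N X. point_property N X Y \<epsilon> \<eta> x)"
  unfolding has_BPBpp_def point_property_def by meson

lemma has_Lpp_iff:
  "has_Lpp N X Y \<longleftrightarrow> (\<forall>\<epsilon>>0. \<forall>x\<in>spheres N X. \<exists>\<eta>>0. point_property N X Y \<epsilon> \<eta> x)"
  unfolding has_Lpp_def point_property_def by meson

text \<open>The point x' is fixed before A because \<open>Lpp\<close> takes \<eta> from the point.
  The factor 2 is the loss in passing from vector-valued to scalar maps; it is absorbed by asking
  for \<epsilon>/2 on the primed side, with the same \<eta>.\<close>

lemma pp_transfer:
  fixes X :: "nat \<Rightarrow> ('k::real_or_complex, 'a) normed_space" and Y :: "('k, 'b) normed_space"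
    and X' :: "nat \<Rightarrow> ('k, 'c) normed_space" and Y' :: "('k, 'd) normed_space"
  assumes transfer: "\<And>x. x \<in> spheres N X \<Longrightarrow> \<exists>x'\<in>spheres N' X'.
      \<forall>A\<in>bounded_multilinear_maps N X Y. opnorm N X Y A = 1 \<longrightarrow>
        (\<exists>A'\<in>bounded_multilinear_maps N' X' Y'. opnorm N' X' Y' A' = 1 \<and>
          vnorm Y (A x) \<le> vnorm Y' (A' x') \<and>
          (\<forall>B'\<in>bounded_multilinear_maps N' X' Y'. opnorm N' X' Y' B' = 1 \<longrightarrow> vnorm Y' (B' x') = 1 \<longrightarrow>
            (\<exists>B\<in>bounded_multilinear_maps N X Y. opnorm N X Y B = 1 \<and> vnorm Y (B x) = 1 \<and>
              opnorm N X Y (map_diff N X Y B A) \<le> 2 * opnorm N' X' Y' (map_diff N' X' Y' B' A'))))"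
    and P: "P = BPBpp \<or> P = Lpp" and hP: "has_property P N' X' Y'"
  shows "has_property P N X Y"
proof -
  \<comment> \<open>A single x' serves all \<epsilon> and \<eta>, so the implication fits both
    orders of the quantifiers.\<close>
  have step: "\<exists>x'\<in>spheres N' X'. \<forall>\<epsilon> \<eta>. point_property N' X' Y' (\<epsilon> / 2) \<eta> x' \<longrightarrow> point_property N X Y \<epsilon> \<eta> x"
    if x: "x \<in> spheres N X" for x
  proof -
    obtain x' where x': "x' \<in> spheres N' X'"
      and tr: "\<And>A. A \<in> bounded_multilinear_maps N X Y \<Longrightarrow> opnorm N X Y A = 1 \<Longrightarrow>
        (\<exists>A'\<in>bounded_multilinear_maps N' X' Y'. opnorm N' X' Y' A' = 1 \<and>
          vnorm Y (A x) \<le> vnorm Y' (A' x') \<and>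
          (\<forall>B'\<in>bounded_multilinear_maps N' X' Y'. opnorm N' X' Y' B' = 1 \<longrightarrow> vnorm Y' (B' x') = 1 \<longrightarrow>
            (\<exists>B\<in>bounded_multilinear_maps N X Y. opnorm N X Y B = 1 \<and> vnorm Y (B x) = 1 \<and>
              opnorm N X Y (map_diff N X Y B A) \<le> 2 * opnorm N' X' Y' (map_diff N' X' Y' B' A'))))"
      using transfer[OF x] by meson
    have "point_property N X Y \<epsilon> \<eta> x" if pp: "point_property N' X' Y' (\<epsilon> / 2) \<eta> x'" for \<epsilon> \<eta>
      unfolding point_property_def
    proof (intro ballI impI)
      fix A assume A: "A \<in> bounded_multilinear_maps N X Y" "opnorm N X Y A = 1" "vnorm Y (A x) > 1 - \<eta>"
      obtain A' where A': "A' \<in> bounded_multilinear_maps N' X' Y'" "opnorm N' X' Y' A' = 1"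
        "vnorm Y (A x) \<le> vnorm Y' (A' x')"
        and B: "\<And>B'. B' \<in> bounded_multilinear_maps N' X' Y' \<Longrightarrow> opnorm N' X' Y' B' = 1 \<Longrightarrow>
          vnorm Y' (B' x') = 1 \<Longrightarrow>
          \<exists>B\<in>bounded_multilinear_maps N X Y. opnorm N X Y B = 1 \<and> vnorm Y (B x) = 1 \<and>
            opnorm N X Y (map_diff N X Y B A) \<le> 2 * opnorm N' X' Y' (map_diff N' X' Y' B' A')"
        using tr[OF A(1,2)] by meson
      have "vnorm Y' (A' x') > 1 - \<eta>" using A(3) A'(3) by linarith
      then obtain B' where B': "B' \<in> bounded_multilinear_maps N' X' Y'" "opnorm N' X' Y' B' = 1"
          "vnorm Y' (B' x') = 1" "opnorm N' X' Y' (map_diff N' X' Y' B' A') < \<epsilon> / 2"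
        using pp A'(1,2) unfolding point_property_def by meson
      obtain B where "B \<in> bounded_multilinear_maps N X Y" "opnorm N X Y B = 1" "vnorm Y (B x) = 1"
          "opnorm N X Y (map_diff N X Y B A) \<le> 2 * opnorm N' X' Y' (map_diff N' X' Y' B' A')"
        using B[OF B'(1-3)] by meson
      then show "\<exists>B\<in>bounded_multilinear_maps N X Y. opnorm N X Y B = 1 \<and> vnorm Y (B x) = 1 \<and>
          opnorm N X Y (map_diff N X Y B A) < \<epsilon>"
        using B'(4) by (intro bexI[of _ B]) auto
    qed
    then show ?thesis using x' by blast
  qed
  show ?thesis
    using P
  proof
    assume P: "P = BPBpp"
    show ?thesis
      using hP step unfolding P has_property.simps has_BPBpp_iff by (meson half_gt_zero)
  next
    assume P: "P = Lpp"
    show ?thesis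
      using hP step unfolding P has_property.simps has_Lpp_iff by (meson half_gt_zero)
  qed
qed

section \<open>Scalar-valued maps\<close>

context banach_family
begin

section \<open>Passing between scalar-valued and vector-valued maps\<close>

lemma tuples_upd_add:
  assumes "x \<in> tuples N X" "i \<in> {1..N}" "v \<in> carrier (X i)" "w \<in> carrier (X i)"
  shows "x(i := v \<oplus>\<^bsub>X i\<^esub> w) \<in> tuples N X"
proof -
  interpret banach_space "X i" using banach assms(2) .
  show ?thesis by (rule PiE_upd[OF assms(1,2)]) (simp add: assms)
qed

lemma tuples_upd_smult:
  assumes "x \<in> tuples N X" "i \<in> {1..N}" "v \<in> carrier (X i)"
  shows "x(i := c \<odot>\<^bsub>X i\<^esub> v) \<in> tuples N X"
proof -
  interpret banach_space "X i" using banach assms(2) .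
  show ?thesis by (rule PiE_upd[OF assms(1,2)]) (simp add: assms)
qed

lemma smult_vector_bounded:
  assumes A: "A \<in> bounded_multilinear_maps N X scalar_space"
    and Y: "banach_space Y" and y: "y \<in> carrier Y"
  shows "(\<lambda>x\<in>tuples N X. A x \<odot>\<^bsub>Y\<^esub> y) \<in> bounded_multilinear_maps N X Y"
proof -
  interpret Y: banach_space Y by (rule Y)
  obtain C where C: "\<forall>x\<in>tuples N X. norm (A x) \<le> C * (\<Prod>i=1..N. vnorm (X i) (x i))"
    using bounded_multilinear_bound[OF A] by auto
  show ?thesis
  proof (rule bounded_multilinear_mapsI[where C = "C * vnorm Y y"])
    fix x assume x: "x \<in> tuples N X"
    have "norm (A x) * vnorm Y y \<le> (C * (\<Prod>i=1..N. vnorm (X i) (x i))) * vnorm Y y"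
      using C x y by (intro mult_right_mono Y.vnorm_nonneg) blast+
    then show "vnorm Y ((\<lambda>x\<in>tuples N X. A x \<odot>\<^bsub>Y\<^esub> y) x) \<le> C * vnorm Y y * (\<Prod>i=1..N. vnorm (X i) (x i))"
      using x y by (simp add: Y.vnorm_smult mult_ac)
  qed (use y in \<open>simp_all add: Y.smult_add_scalar Y.smult_smult tuples_upd_add tuples_upd_smult PiE_upd
      bounded_multilinear_add[OF A, unfolded add_scalar_space]
      bounded_multilinear_smult[OF A, unfolded smult_scalar_space] del: One_nat_def\<close>)
qed

lemma compose_dual_bounded:
  assumes B: "B \<in> bounded_multilinear_maps N X Y" and Y: "banach_space Y"
    and f: "f \<in> carrier (dual_space Y)"
  shows "(\<lambda>x\<in>tuples N X. c * f (B x)) \<in> bounded_multilinear_maps N X scalar_space"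
proof -
  interpret Y: banach_space Y by (rule Y)
  obtain C where C: "\<forall>x\<in>tuples N X. vnorm Y (B x) \<le> C * (\<Prod>i=1..N. vnorm (X i) (x i))"
    using bounded_multilinear_bound[OF B] by auto
  obtain D where D: "\<forall>v\<in>carrier Y. norm (f v) \<le> D * vnorm Y v"
    using dual_bound[OF f] by blast
  note closed = bounded_multilinear_closed[OF B]
  show ?thesis
  \<comment> \<open>D is an arbitrary witness of boundedness; its absolute value is certainly
    nonnegative and may multiply the bound for B. The factor c is there for the later
    rotation.\<close>
  proof (rule bounded_multilinear_mapsI[where C = "norm c * (\<bar>D\<bar> * C)"])
    fix x assume x: "x \<in> tuples N X"
    have "norm (f (B x)) \<le> D * vnorm Y (B x)"
      using D closed[OF x] by blast
    also have "\<dots> \<le> \<bar>D\<bar> * vnorm Y (B x)"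
      using Y.vnorm_nonneg[OF closed[OF x]] by (intro mult_right_mono) auto
    also have "\<dots> \<le> \<bar>D\<bar> * (C * (\<Prod>i=1..N. vnorm (X i) (x i)))"
      using C x by (intro mult_left_mono) auto
    finally have "norm c * norm (f (B x)) \<le> norm c * (\<bar>D\<bar> * (C * (\<Prod>i=1..N. vnorm (X i) (x i))))"
      by (intro mult_left_mono) auto
    then show "vnorm scalar_space ((\<lambda>x\<in>tuples N X. c * f (B x)) x) \<le>
      norm c * (\<bar>D\<bar> * C) * (\<Prod>i=1..N. vnorm (X i) (x i))"
      using x by (simp add: norm_mult mult_ac)
  next
    fix x i v w assume x: "x \<in> tuples N X" "i \<in> {1..N}" "v \<in> carrier (X i)" "w \<in> carrier (X i)"
    have "x(i := v) \<in> tuples N X" "x(i := w) \<in> tuples N X"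
      using x by (auto intro: PiE_upd)
    then show "(\<lambda>x\<in>tuples N X. c * f (B x)) (x(i := v \<oplus>\<^bsub>X i\<^esub> w)) =
       (\<lambda>x\<in>tuples N X. c * f (B x)) (x(i := v)) \<oplus>\<^bsub>scalar_space\<^esub> (\<lambda>x\<in>tuples N X. c * f (B x)) (x(i := w))"
      using tuples_upd_add[OF x] bounded_multilinear_add[OF B x] closed
      by (simp add: dual_add[OF f] distrib_left del: One_nat_def)
  next
    fix x i a v assume x: "x \<in> tuples N X" "i \<in> {1..N}" "v \<in> carrier (X i)"
    have "x(i := v) \<in> tuples N X"
      using x by (auto intro: PiE_upd)
    then show "(\<lambda>x\<in>tuples N X. c * f (B x)) (x(i := a \<odot>\<^bsub>X i\<^esub> v)) =
       a \<odot>\<^bsub>scalar_space\<^esub> (\<lambda>x\<in>tuples N X. c * f (B x)) (x(i := v))"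
      using tuples_upd_smult[OF x] bounded_multilinear_smult[OF B x] closed
      by (simp add: dual_smult[OF f] del: One_nat_def)
  qed simp
qed

text \<open>Given a map \<open>B\<close> near \<open>A y\<close> with \<open>B x\<close> of norm one, compose \<open>B\<close> with a functional norming
  \<open>B x\<close>: it almost norms \<open>y\<close>, so a rotation makes its value at \<open>y\<close> close to 1.\<close>

lemma scalar_of_vector_pp:
  assumes Y: "banach_space Y" and y: "y \<in> unit_sphere Y"
    and A: "A \<in> bounded_multilinear_maps N X scalar_space" "opnorm N X scalar_space A = 1"
    and B: "B \<in> bounded_multilinear_maps N X Y" "opnorm N X Y B = 1"
    and x: "x \<in> spheres N X" "vnorm Y (B x) = 1"
    and Ay: "Ay = (\<lambda>x\<in>tuples N X. A x \<odot>\<^bsub>Y\<^esub> y)"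
  shows "\<exists>G\<in>bounded_multilinear_maps N X scalar_space. opnorm N X scalar_space G = 1 \<and>
    norm (G x) = 1 \<and>
    opnorm N X scalar_space (map_diff N X scalar_space G A) \<le> 2 * opnorm N X Y (map_diff N X Y B Ay)"
proof -
  interpret Y: banach_space Y by (rule Y)
  note yc = unit_sphereD(1)[OF y]
  have Ay_bounded: "Ay \<in> bounded_multilinear_maps N X Y"
    unfolding Ay by (rule smult_vector_bounded[OF A(1) Y yc])
  note closed = bounded_multilinear_closed[OF B(1)]
  obtain f where f: "f \<in> carrier (dual_space Y)" and f_le: "\<And>v. v \<in> carrier Y \<Longrightarrow> norm (f v) \<le> vnorm Y v"
    and fx: "f (B x) = 1"
    using Y.ex_norming_functional[OF closed[OF spheres_tuples[OF x(1)]]] x(2) by auto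
  define \<delta> where "\<delta> = opnorm N X Y (map_diff N X Y B Ay)"
  have diff: "norm (f (B z) - A z * f y) \<le> \<delta>" if z: "z \<in> spheres N X" for z
  proof -
    note zt = spheres_tuples[OF z]
    \<comment> \<open>Written as a sum with a scalar multiple of y, the difference can be evaluated
      by the linearity of f.\<close>
    have eq: "map_diff N X Y B Ay z = B z \<oplus>\<^bsub>Y\<^esub> (- A z) \<odot>\<^bsub>Y\<^esub> y"
    proof -
      have "(- 1) \<odot>\<^bsub>Y\<^esub> (A z \<odot>\<^bsub>Y\<^esub> y) = \<ominus>\<^bsub>Y\<^esub> (A z \<odot>\<^bsub>Y\<^esub> y)"
        using yc by (simp add: Y.smult_minus_1)
      then show ?thesis
        using zt yc by (simp add: map_diff_def Ay a_minus_def Y.smult_smult)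
    qed
    have "f (B z) - A z * f y = f (map_diff N X Y B Ay z)"
      unfolding eq using closed[OF zt] yc by (simp add: dual_add[OF f] dual_smult[OF f])
    also have "norm \<dots> \<le> vnorm Y (map_diff N X Y B Ay z)"
      unfolding eq using closed[OF zt] yc by (intro f_le) simp
    also have "\<dots> \<le> \<delta>"
      unfolding \<delta>_def
      by (intro opnorm_upper_bdd bdd_above_map_diff Ay_bounded B(1) z Y.vnorm_minus_le)
    finally show ?thesis .
  qed
  have A_le: "norm (A z) \<le> 1" if "z \<in> spheres N X" for z
    using opnorm_upper[OF A(1) that] A(2) by simp
  define r where "r = norm (f y)"
  have r_le: "r \<le> 1"
    using f_le[OF yc] unit_sphereD(2)[OF y] by (simp add: r_def)
  \<comment> \<open>At x the composed map has value 1 while |A(x) f(y)| \<le> r, so the distance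
    \<delta> must cover the gap 1 - r.\<close>
  have r_ge: "1 - r \<le> \<delta>"
  proof -
    have "1 = norm (f (B x))" using fx by simp
    also have "\<dots> \<le> norm (f (B x) - A x * f y) + norm (A x * f y)"
      by (metis diff_add_cancel norm_triangle_ineq)
    also have "\<dots> \<le> \<delta> + r"
      using diff[OF x(1)] A_le[OF x(1)] unfolding r_def norm_mult
      by (intro add_mono) (auto intro: mult_left_le_one_le)
    finally show ?thesis by simp
  qed
  \<comment> \<open>Rotates f(y) to its modulus r. If f(y) = 0 then r = 0 and any unimodular number
    will do; 1 is taken.\<close>
  define \<theta> where "\<theta> = (if f y = 0 then 1 else of_real r / f y)"
  have \<theta>: "norm \<theta> = 1" "\<theta> * f y = of_real r"
    by (auto simp: \<theta>_def r_def norm_divide)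
  define G where "G = (\<lambda>x\<in>tuples N X. \<theta> * f (B x))"
  have G: "G \<in> bounded_multilinear_maps N X scalar_space"
    unfolding G_def by (rule compose_dual_bounded[OF B(1) Y f])
  have G_norm: "norm (G z) = norm (f (B z))" if "z \<in> spheres N X" for z
    using spheres_tuples[OF that] \<theta> by (simp add: G_def norm_mult)
  have "norm (G z) \<le> 1" if z: "z \<in> spheres N X" for z
    using f_le[OF closed[OF spheres_tuples[OF z]]] opnorm_upper[OF B(1) z] B(2) G_norm[OF z] by simp
  moreover have Gx: "norm (G x) = 1"
    using G_norm[OF x(1)] fx by simp
  ultimately have "opnorm N X scalar_space G = 1"
    using x(1) by (intro opnorm_eq_1I[OF G, of x]) auto
  moreover have "opnorm N X scalar_space (map_diff N X scalar_space G A) \<le> 2 * \<delta>"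
  proof (rule opnorm_least[OF spheres_nonempty])
    fix z assume z: "z \<in> spheres N X"
    \<comment> \<open>Since \<theta> f(y) = r, the error splits into the rotated image of the vector
      difference, at most \<delta>, and a multiple of A(z) of size at most 1 - r \<le>
      \<delta>.\<close>
    have "G z - A z = \<theta> * (f (B z) - A z * f y) - of_real (1 - r) * A z"
      using spheres_tuples[OF z] \<theta>(2) by (simp add: G_def algebra_simps)
    then have "norm (G z - A z) \<le> norm (\<theta> * (f (B z) - A z * f y)) + norm (of_real (1 - r) * A z)"
      using norm_triangle_ineq4 by metis
    also have "\<dots> = norm (f (B z) - A z * f y) + (1 - r) * norm (A z)"
      using \<theta>(1) r_le unfolding norm_mult norm_of_real by simp
    also have "\<dots> \<le> \<delta> + (1 - r) * 1"
      using r_le by (intro add_mono mult_left_mono diff z A_le) simp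
    finally show "vnorm scalar_space (map_diff N X scalar_space G A z) \<le> 2 * \<delta>"
      using r_ge spheres_tuples[OF z] by (simp add: map_diff_def)
  qed
  ultimately show ?thesis
    using G Gx unfolding \<delta>_def by (intro bexI[of _ G]) auto
qed

text \<open>The o-properties see only the numbers |A(x)|, which \<open>lift\<close> preserves, so
  the points stay the same. The p-properties produce an arbitrary vector-valued B' near
  \<open>lift A\<close>, not itself of the form \<open>lift G\<close>;
  \<open>scalar_of_vector_pp\<close> extracts a scalar map from it.\<close>

proposition scalar_of_vector:
  assumes Y: "banach_space Y" "carrier Y \<noteq> {\<zero>\<^bsub>Y\<^esub>}" and P: "has_property P N X Y"
  shows "has_property P N X (scalar_space :: ('k, 'k) normed_space)"
proof -
  interpret Y: banach_space Y by (rule Y)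
  obtain y where y: "y \<in> unit_sphere Y" using Y.unit_sphere_nonempty Y(2) by blast
  note yD = unit_sphereD[OF y]
  define lift where "lift A = (\<lambda>x\<in>tuples N X. A x \<odot>\<^bsub>Y\<^esub> y)" for A
  have lift: "lift A \<in> bounded_multilinear_maps N X Y" if "A \<in> bounded_multilinear_maps N X scalar_space" for A
    unfolding lift_def by (rule smult_vector_bounded[OF that Y(1) yD(1)])
  have lift_norm: "vnorm Y (lift A x) = norm (A x)" if "x \<in> spheres N X" for A x
    using spheres_tuples[OF that] yD by (simp add: lift_def Y.vnorm_smult)
  have lift_opnorm: "opnorm N X Y (lift A) = opnorm N X scalar_space A" for A
    by (rule opnorm_cong) (simp add: lift_norm)
  consider "P = BPBop \<or> P = Loo" | "P = BPBpp \<or> P = Lpp" by (cases P) auto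
  then show ?thesis
  proof cases
    case 1
    show ?thesis
    proof (rule op_transfer[OF _ 1 P])
      fix A :: "(nat \<Rightarrow> 'a) \<Rightarrow> 'k"
      assume A: "A \<in> bounded_multilinear_maps N X scalar_space" "opnorm N X scalar_space A = 1"
      show "\<exists>A'\<in>bounded_multilinear_maps N X Y. opnorm N X Y A' = 1 \<and>
        (\<forall>\<eta>. \<forall>x\<in>spheres N X. vnorm scalar_space (A x) > 1 - \<eta> \<longrightarrow>
          (\<exists>x'\<in>spheres N X. vnorm Y (A' x') > 1 - \<eta> \<and>
            (\<forall>z'\<in>spheres N X. vnorm Y (A' z') = 1 \<longrightarrow>
              (\<exists>z\<in>spheres N X. vnorm scalar_space (A z) = 1 \<and> tuple_dist N X x z \<le> tuple_dist N X x' z'))))"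
        using lift[OF A(1)] A(2)
        by (intro bexI[of _ "lift A"] conjI allI ballI impI) (auto simp: lift_opnorm lift_norm)
    qed
  next
    case 2
    show ?thesis
    proof (rule pp_transfer[OF _ 2 P])
      fix x assume x: "x \<in> spheres N X"
      show "\<exists>x'\<in>spheres N X. \<forall>A\<in>bounded_multilinear_maps N X (scalar_space :: ('k, 'k) normed_space).
        opnorm N X scalar_space A = 1 \<longrightarrow>
        (\<exists>A'\<in>bounded_multilinear_maps N X Y. opnorm N X Y A' = 1 \<and>
          vnorm scalar_space (A x) \<le> vnorm Y (A' x') \<and>
          (\<forall>B'\<in>bounded_multilinear_maps N X Y. opnorm N X Y B' = 1 \<longrightarrow> vnorm Y (B' x') = 1 \<longrightarrow>
            (\<exists>B\<in>bounded_multilinear_maps N X scalar_space. opnorm N X scalar_space B = 1 \<and>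
              vnorm scalar_space (B x) = 1 \<and>
              opnorm N X scalar_space (map_diff N X scalar_space B A) \<le>
                2 * opnorm N X Y (map_diff N X Y B' A'))))"
      proof (intro bexI[OF _ x] ballI impI)
        fix A :: "(nat \<Rightarrow> 'a) \<Rightarrow> 'k"
        assume A: "A \<in> bounded_multilinear_maps N X scalar_space" "opnorm N X scalar_space A = 1"
        have "\<exists>B\<in>bounded_multilinear_maps N X scalar_space. opnorm N X scalar_space B = 1 \<and>
              vnorm scalar_space (B x) = 1 \<and>
              opnorm N X scalar_space (map_diff N X scalar_space B A) \<le>
                2 * opnorm N X Y (map_diff N X Y B' (lift A))"
          if "B' \<in> bounded_multilinear_maps N X Y" "opnorm N X Y B' = 1" "vnorm Y (B' x) = 1" for B'
          unfolding vnorm_scalar_space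
          by (rule scalar_of_vector_pp[OF Y(1) y A that(1,2) x that(3)]) (simp add: lift_def)
        then show "\<exists>A'\<in>bounded_multilinear_maps N X Y. opnorm N X Y A' = 1 \<and>
          vnorm scalar_space (A x) \<le> vnorm Y (A' x) \<and>
          (\<forall>B'\<in>bounded_multilinear_maps N X Y. opnorm N X Y B' = 1 \<longrightarrow> vnorm Y (B' x) = 1 \<longrightarrow>
            (\<exists>B\<in>bounded_multilinear_maps N X scalar_space. opnorm N X scalar_space B = 1 \<and>
              vnorm scalar_space (B x) = 1 \<and>
              opnorm N X scalar_space (map_diff N X scalar_space B A) \<le>
                2 * opnorm N X Y (map_diff N X Y B' A')))"
          using lift[OF A(1)] A(2) x
          by (intro bexI[of _ "lift A"] conjI ballI impI) (simp_all add: lift_opnorm lift_norm)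
      qed
    qed
  qed
qed

end

section \<open>Restriction to one factor\<close>

text \<open>A 1-linear map takes a tuple indexed by {1..1} instead of a vector; this is that tuple,
  extensional as all tuples are.\<close>

abbreviation single :: "'a \<Rightarrow> nat \<Rightarrow> 'a" where
  "single v \<equiv> (\<lambda>_. undefined)(1 := v)"

lemma single_in_PiE: "v \<in> F 1 \<Longrightarrow> single v \<in> Pi\<^sub>E {1..1} F"
  by (auto simp: PiE_iff extensional_def)

lemma single_eta: "y \<in> Pi\<^sub>E {1..1} F \<Longrightarrow> single (y 1) = y"
  by (auto simp: PiE_iff extensional_def fun_eq_iff)

context banach_family
begin

text \<open>A(z) is F at the i-th entry times the product of f_j(z_j) over j other than i, where f_j
  norms the j-th entry of x0. At x0 the extra factors are 1, so freezing recovers F; elsewhere on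
  the spheres they are at most 1 in modulus, so wherever |A| = 1 the i-th coordinate attains the
  norm of F.\<close>

lemma factor_extension:
  fixes F :: "(nat \<Rightarrow> 'a) \<Rightarrow> 'k"
  assumes i: "i \<in> {1..N}" and x0: "x0 \<in> spheres N X"
    and F: "F \<in> bounded_multilinear_maps 1 (\<lambda>_. X i) scalar_space"
      "opnorm 1 (\<lambda>_. X i) scalar_space F = 1"
  shows "\<exists>A\<in>bounded_multilinear_maps N X scalar_space. opnorm N X scalar_space A = 1 \<and>
    (\<forall>v\<in>carrier (X i). A (x0(i := v)) = F (single v)) \<and>
    (\<forall>z\<in>spheres N X. norm (A z) \<le> norm (F (single (z i))))"
proof -
  let ?Z = "\<lambda>_ :: nat. X i"
  interpret Xi: banach_space "X i" by (rule banach[OF i])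
  define \<phi> where "\<phi> = (\<lambda>v\<in>carrier (X i). F (single v))"
  \<comment> \<open>The zero vector is a placeholder, overwritten by v; it only supplies a tuple in
    the carrier.\<close>
  have "(\<lambda>v\<in>carrier (?Z 1). F ((single \<zero>\<^bsub>X i\<^esub>)(1 := v))) \<in> carrier (dual_space (?Z 1))"
    by (rule slice_in_dual[OF F(1) banach[OF i] single_in_PiE]) simp_all
  then have \<phi>: "\<phi> \<in> carrier (dual_space (X i))"
    by (simp add: \<phi>_def)
  have single_sphere: "single v \<in> spheres 1 ?Z" if "v \<in> unit_sphere (X i)" for v
    unfolding spheres_def using that by (rule single_in_PiE)
  have \<phi>_le: "norm (\<phi> v) \<le> 1" if "v \<in> unit_sphere (X i)" for v
    using opnorm_upper[OF F(1) single_sphere[OF that]] F(2) unit_sphereD(1)[OF that]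
    by (simp add: \<phi>_def)
  have "\<exists>f. f \<in> carrier (dual_space (X j)) \<and> (\<forall>v\<in>carrier (X j). norm (f v) \<le> vnorm (X j) v) \<and>
      f (x0 j) = 1" if j: "j \<in> {1..N}" for j
    using banach_space.ex_norming_functional[OF banach[OF j] unit_sphereD(1)[OF spheresD[OF x0 j]]]
      unit_sphereD(2)[OF spheresD[OF x0 j]] by simp
  then obtain f where f: "\<And>j. j \<in> {1..N} \<Longrightarrow> f j \<in> carrier (dual_space (X j))"
    and f_le: "\<And>j v. j \<in> {1..N} \<Longrightarrow> v \<in> carrier (X j) \<Longrightarrow> norm (f j v) \<le> vnorm (X j) v"
    and f_x0: "\<And>j. j \<in> {1..N} \<Longrightarrow> f j (x0 j) = 1"
    by metis
  define A where "A = product_map N X (f(i := \<phi>))"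
  have A: "A \<in> bounded_multilinear_maps N X scalar_space"
    unfolding A_def using f \<phi> by (intro product_map_bounded) simp
  have A_eq: "A z = \<phi> (z i) * (\<Prod>j\<in>{1..N} - {i}. f j (z j))" if z: "z \<in> tuples N X" for z
    using z i by (simp add: A_def product_map_def prod.remove[of _ i] del: One_nat_def)
  have A_x0: "A (x0(i := v)) = F (single v)" if v: "v \<in> carrier (X i)" for v
  proof -
    have "(\<Prod>j\<in>{1..N} - {i}. f j ((x0(i := v)) j)) = 1"
      using f_x0 by (intro prod.neutral) auto
    then show ?thesis
      using A_eq[OF PiE_upd[OF spheres_tuples[OF x0] i v]] v by (simp add: \<phi>_def)
  qed
  have A_le: "norm (A z) \<le> norm (F (single (z i)))" if z: "z \<in> spheres N X" for z
  proof -
    have "(\<Prod>j\<in>{1..N} - {i}. norm (f j (z j))) \<le> 1"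
    proof (intro prod_le_1 conjI norm_ge_zero)
      fix j assume "j \<in> {1..N} - {i}"
      then show "norm (f j (z j)) \<le> 1"
        using f_le[of j "z j"] unit_sphereD[OF spheresD[OF z, of j]] by simp
    qed
    then have "norm (\<phi> (z i)) * (\<Prod>j\<in>{1..N} - {i}. norm (f j (z j))) \<le> norm (\<phi> (z i))"
      by (intro mult_right_le_one_le) (auto intro: prod_nonneg)
    then show ?thesis
      using A_eq[OF spheres_tuples[OF z]] unit_sphereD(1)[OF spheresD[OF z i]]
      by (simp add: norm_mult \<phi>_def flip: prod_norm)
  qed
  have "opnorm N X scalar_space A = 1"
  proof (rule antisym)
    show "opnorm N X scalar_space A \<le> 1"
    proof (rule opnorm_least[OF spheres_nonempty])
      fix z assume z: "z \<in> spheres N X"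
      show "vnorm scalar_space (A z) \<le> 1"
        using A_le[OF z] opnorm_upper[OF F(1) single_sphere[OF spheresD[OF z i]]] F(2) by simp
    qed
    \<comment> \<open>Each value of F on the sphere is a value of A at x0 with its i-th entry
      replaced, so A cannot have smaller norm.\<close>
    have "opnorm 1 ?Z scalar_space F \<le> opnorm N X scalar_space A"
    proof (rule opnorm_least)
      show "spheres 1 ?Z \<noteq> {}"
        using single_sphere[OF spheresD[OF x0 i]] by blast
      fix y assume y: "y \<in> spheres 1 ?Z"
      have y1: "y 1 \<in> unit_sphere (X i)" using spheresD[OF y] by simp
      have "F y = A (x0(i := y 1))"
        using A_x0[OF unit_sphereD(1)[OF y1]] single_eta[OF spheres_tuples[OF y]] by simp
      then show "vnorm scalar_space (F y) \<le> opnorm N X scalar_space A"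
        using opnorm_upper[OF A spheres_upd[OF x0 i y1]] by simp
    qed
    then show "1 \<le> opnorm N X scalar_space A" using F(2) by simp
  qed
  then show ?thesis using A A_x0 A_le by blast
qed

text \<open>One vector x0 of the spheres is fixed throughout, so the point built from y is
  independent of the functional and A is independent of y. Both transfer lemmas therefore
  apply.\<close>

proposition factor_of_product:
  assumes i: "i \<in> {1..N}" and P: "has_property P N X (scalar_space :: ('k, 'k) normed_space)"
  shows "has_property P 1 (\<lambda>_. X i) (scalar_space :: ('k, 'k) normed_space)"
proof -
  let ?Z = "\<lambda>_ :: nat. X i" and ?K = "scalar_space :: ('k, 'k) normed_space"
  obtain x0 where x0: "x0 \<in> spheres N X" using spheres_nonempty by blast
  interpret Z: banach_family 1 ?Z
    by (rule banach_family.intro) (rule banach[OF i], rule nonzero[OF i])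
  have sphere: "y 1 \<in> unit_sphere (X i)" if "y \<in> spheres 1 ?Z" for y
    using spheresD[OF that] by simp
  have upd: "x0(i := y 1) \<in> spheres N X" if "y \<in> spheres 1 ?Z" for y
    using spheres_upd[OF x0 i sphere[OF that]] .
  have eta: "single (y 1) = y" if "y \<in> spheres 1 ?Z" for y
    using single_eta[OF spheres_tuples[OF that]] .
  have A_y: "A (x0(i := y 1)) = F y"
    if "\<forall>v\<in>carrier (X i). A (x0(i := v)) = F (single v)" "y \<in> spheres 1 ?Z"
    for A F :: "(nat \<Rightarrow> 'a) \<Rightarrow> 'k" and y
    using that(1) unit_sphereD(1)[OF sphere[OF that(2)]] eta[OF that(2)] by simp
  consider "P = BPBop \<or> P = Loo" | "P = BPBpp \<or> P = Lpp" by (cases P) auto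
  then show ?thesis
  proof cases
    case 1
    show ?thesis
    proof (rule op_transfer[OF _ 1 P])
      fix F :: "(nat \<Rightarrow> 'a) \<Rightarrow> 'k"
      assume F: "F \<in> bounded_multilinear_maps 1 ?Z ?K" "opnorm 1 ?Z ?K F = 1"
      obtain A where A: "A \<in> bounded_multilinear_maps N X ?K" "opnorm N X ?K A = 1"
        and A_x0: "\<forall>v\<in>carrier (X i). A (x0(i := v)) = F (single v)"
        and A_le: "\<forall>z\<in>spheres N X. norm (A z) \<le> norm (F (single (z i)))"
        using factor_extension[OF i x0 F] by (elim bexE conjE) (rule that)
      show "\<exists>A\<in>bounded_multilinear_maps N X ?K. opnorm N X ?K A = 1 \<and>
        (\<forall>\<eta>. \<forall>y\<in>spheres 1 ?Z. vnorm ?K (F y) > 1 - \<eta> \<longrightarrow>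
          (\<exists>x'\<in>spheres N X. vnorm ?K (A x') > 1 - \<eta> \<and>
            (\<forall>z'\<in>spheres N X. vnorm ?K (A z') = 1 \<longrightarrow>
              (\<exists>z\<in>spheres 1 ?Z. vnorm ?K (F z) = 1 \<and> tuple_dist 1 ?Z y z \<le> tuple_dist N X x' z'))))"
      proof (intro bexI[OF _ A(1)] conjI A(2) allI ballI impI)
        fix \<eta> y assume y: "y \<in> spheres 1 ?Z" "vnorm ?K (F y) > 1 - \<eta>"
        show "\<exists>x'\<in>spheres N X. vnorm ?K (A x') > 1 - \<eta> \<and>
            (\<forall>z'\<in>spheres N X. vnorm ?K (A z') = 1 \<longrightarrow>
              (\<exists>z\<in>spheres 1 ?Z. vnorm ?K (F z) = 1 \<and> tuple_dist 1 ?Z y z \<le> tuple_dist N X x' z'))"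
        proof (intro bexI[OF _ upd[OF y(1)]] conjI ballI impI)
          show "vnorm ?K (A (x0(i := y 1))) > 1 - \<eta>"
            unfolding A_y[OF A_x0 y(1)] by (rule y(2))
          fix z' assume z': "z' \<in> spheres N X" "vnorm ?K (A z') = 1"
          have z: "single (z' i) \<in> spheres 1 ?Z"
            unfolding spheres_def using spheresD[OF z'(1) i] by (rule single_in_PiE)
          \<comment> \<open>Squeezed between |A(z')| = 1 from below and the norm of F from
            above.\<close>
          have "norm (F (single (z' i))) = 1"
            using A_le z' opnorm_upper[OF F(1) z] F(2) by force
          \<comment> \<open>The distance in one variable is the i-th term of the maximum over all
            coordinates.\<close>
          moreover have "tuple_dist 1 ?Z y (single (z' i)) \<le> tuple_dist N X (x0(i := y 1)) z'"
            using tuple_dist_upper[OF i, of X "x0(i := y 1)" z'] by (simp add: tuple_dist_def)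
          ultimately show "\<exists>z\<in>spheres 1 ?Z. vnorm ?K (F z) = 1 \<and>
              tuple_dist 1 ?Z y z \<le> tuple_dist N X (x0(i := y 1)) z'"
            using z by (intro bexI[OF _ z]) simp
        qed
      qed
    qed
  next
    case 2
    show ?thesis
    proof (rule pp_transfer[OF _ 2 P])
      fix y assume y: "y \<in> spheres 1 ?Z"
      let ?x = "x0(i := y 1)"
      show "\<exists>x'\<in>spheres N X. \<forall>F\<in>bounded_multilinear_maps 1 ?Z ?K.
        opnorm 1 ?Z ?K F = 1 \<longrightarrow>
        (\<exists>A\<in>bounded_multilinear_maps N X ?K. opnorm N X ?K A = 1 \<and>
          vnorm ?K (F y) \<le> vnorm ?K (A x') \<and>
          (\<forall>B\<in>bounded_multilinear_maps N X ?K. opnorm N X ?K B = 1 \<longrightarrow> vnorm ?K (B x') = 1 \<longrightarrow>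
            (\<exists>G\<in>bounded_multilinear_maps 1 ?Z ?K. opnorm 1 ?Z ?K G = 1 \<and> vnorm ?K (G y) = 1 \<and>
              opnorm 1 ?Z ?K (map_diff 1 ?Z ?K G F) \<le> 2 * opnorm N X ?K (map_diff N X ?K B A))))"
      proof (intro bexI[OF _ upd[OF y]] ballI impI)
        fix F :: "(nat \<Rightarrow> 'a) \<Rightarrow> 'k"
        assume F: "F \<in> bounded_multilinear_maps 1 ?Z ?K" "opnorm 1 ?Z ?K F = 1"
        obtain A where A: "A \<in> bounded_multilinear_maps N X ?K" "opnorm N X ?K A = 1"
          and A_x0: "\<forall>v\<in>carrier (X i). A (x0(i := v)) = F (single v)"
          using factor_extension[OF i x0 F] by (elim bexE conjE) (rule that)
        show "\<exists>A\<in>bounded_multilinear_maps N X ?K. opnorm N X ?K A = 1 \<and>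
          vnorm ?K (F y) \<le> vnorm ?K (A ?x) \<and>
          (\<forall>B\<in>bounded_multilinear_maps N X ?K. opnorm N X ?K B = 1 \<longrightarrow> vnorm ?K (B ?x) = 1 \<longrightarrow>
            (\<exists>G\<in>bounded_multilinear_maps 1 ?Z ?K. opnorm 1 ?Z ?K G = 1 \<and> vnorm ?K (G y) = 1 \<and>
              opnorm 1 ?Z ?K (map_diff 1 ?Z ?K G F) \<le> 2 * opnorm N X ?K (map_diff N X ?K B A)))"
        proof (intro bexI[OF _ A(1)] conjI A(2) ballI impI)
          show "vnorm ?K (F y) \<le> vnorm ?K (A ?x)"
            by (simp only: A_y[OF A_x0 y])
          fix B :: "(nat \<Rightarrow> 'a) \<Rightarrow> 'k"
          assume B: "B \<in> bounded_multilinear_maps N X ?K" "opnorm N X ?K B = 1" "vnorm ?K (B ?x) = 1"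
          \<comment> \<open>B with all variables but the i-th frozen at x0, turned from a functional
            into a 1-linear map.\<close>
          define G where "G = product_map 1 ?Z (\<lambda>_. \<lambda>v\<in>carrier (X i). B (x0(i := v)))"
          have G: "G \<in> bounded_multilinear_maps 1 ?Z ?K"
            unfolding G_def
            by (rule Z.product_map_bounded) (rule slice_in_dual[OF B(1) banach[OF i] spheres_tuples[OF x0] i])
          have G_eq: "G w = B (x0(i := w 1))" if w: "w \<in> spheres 1 ?Z" for w
            using spheres_tuples[OF w] unit_sphereD(1)[OF sphere[OF w]]
            by (simp add: G_def product_map_def)
          have Gy: "norm (G y) = 1" using G_eq[OF y] B(3) by simp
          have "norm (G w) \<le> 1" if w: "w \<in> spheres 1 ?Z" for w
            using opnorm_upper[OF B(1) upd[OF w]] G_eq[OF w] B(2) by simp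
          then have "opnorm 1 ?Z ?K G = 1"
            using Gy by (intro opnorm_eq_1I[OF G _ y]) simp_all
          moreover have "opnorm 1 ?Z ?K (map_diff 1 ?Z ?K G F) \<le> 2 * opnorm N X ?K (map_diff N X ?K B A)"
          proof (rule opnorm_least[OF Z.spheres_nonempty])
            fix w assume w: "w \<in> spheres 1 ?Z"
            have "map_diff 1 ?Z ?K G F w = B (x0(i := w 1)) - A (x0(i := w 1))"
              using spheres_tuples[OF w] G_eq[OF w] unfolding A_y[OF A_x0 w] by (simp add: map_diff_def)
            then have "norm (map_diff 1 ?Z ?K G F w) \<le> opnorm N X ?K (map_diff N X ?K B A)"
              using norm_diff_le_opnorm_scalar[OF A(1) B(1) upd[OF w]] by simp
            \<comment> \<open>Freezing does not increase distances; the estimate is weakened by the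
              factor 2 to match \<open>pp_transfer\<close>.\<close>
            then show "vnorm ?K (map_diff 1 ?Z ?K G F w) \<le> 2 * opnorm N X ?K (map_diff N X ?K B A)"
              using norm_ge_zero[of "map_diff 1 ?Z ?K G F w"] unfolding vnorm_scalar_space by linarith
          qed
          ultimately show "\<exists>G\<in>bounded_multilinear_maps 1 ?Z ?K. opnorm 1 ?Z ?K G = 1 \<and>
              vnorm ?K (G y) = 1 \<and>
              opnorm 1 ?Z ?K (map_diff 1 ?Z ?K G F) \<le> 2 * opnorm N X ?K (map_diff N X ?K B A)"
            using Gy by (intro bexI[OF _ G]) simp
        qed
      qed
    qed
  qed
qed

end

section \<open>Currying the last variable\<close>

lemma PiE_Suc_upd: "x \<in> Pi\<^sub>E {1..n} F \<Longrightarrow> v \<in> F (Suc n) \<Longrightarrow> x(Suc n := v) \<in> Pi\<^sub>E {1..Suc n} F"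
  by (auto simp: PiE_iff extensional_def)

lemma PiE_Suc_restrict: "x \<in> Pi\<^sub>E {1..Suc n} F \<Longrightarrow> restrict x {1..n} \<in> Pi\<^sub>E {1..n} F"
  by (auto simp: PiE_iff)

lemma PiE_Suc_eta: "x \<in> Pi\<^sub>E {1..Suc n} F \<Longrightarrow> (restrict x {1..n})(Suc n := x (Suc n)) = x"
  by (auto simp: PiE_iff extensional_def fun_eq_iff)

lemma PiE_restrict_upd: "x \<in> Pi\<^sub>E {1..n} F \<Longrightarrow> restrict (x(Suc n := v)) {1..n} = x"
  by (auto simp: PiE_iff extensional_def fun_eq_iff)

definition curry_last ::
  "nat \<Rightarrow> (nat \<Rightarrow> ('k::real_or_complex, 'a) normed_space) \<Rightarrow> ((nat \<Rightarrow> 'a) \<Rightarrow> 'k) \<Rightarrow> (nat \<Rightarrow> 'a) \<Rightarrow> 'a \<Rightarrow> 'k" where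
  "curry_last n X C = (\<lambda>x\<in>tuples n X. \<lambda>v\<in>carrier (X (Suc n)). C (x(Suc n := v)))"

definition uncurry_last ::
  "nat \<Rightarrow> (nat \<Rightarrow> ('k::real_or_complex, 'a) normed_space) \<Rightarrow> ((nat \<Rightarrow> 'a) \<Rightarrow> 'a \<Rightarrow> 'k) \<Rightarrow> (nat \<Rightarrow> 'a) \<Rightarrow> 'k" where
  "uncurry_last n X A = (\<lambda>x\<in>tuples (Suc n) X. A (restrict x {1..n}) (x (Suc n)))"

lemma curry_last_apply:
  "x \<in> tuples n X \<Longrightarrow> v \<in> carrier (X (Suc n)) \<Longrightarrow> curry_last n X C x v = C (x(Suc n := v))"
  by (simp add: curry_last_def)

lemma uncurry_last_apply:
  "x \<in> tuples (Suc n) X \<Longrightarrow> uncurry_last n X A x = A (restrict x {1..n}) (x (Suc n))"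
  by (simp add: uncurry_last_def)

lemma spheres_Suc_upd:
  "x \<in> spheres n X \<Longrightarrow> v \<in> unit_sphere (X (Suc n)) \<Longrightarrow> x(Suc n := v) \<in> spheres (Suc n) X"
  unfolding spheres_def by (rule PiE_Suc_upd)

lemma spheres_Suc_restrict: "x \<in> spheres (Suc n) X \<Longrightarrow> restrict x {1..n} \<in> spheres n X"
  unfolding spheres_def by (rule PiE_Suc_restrict)

text \<open>Dropping a coordinate removes one term from the maximum; \<open>1 \<le> n\<close> keeps
  a term in it.\<close>

lemma tuple_dist_restrict:
  assumes "1 \<le> n"
  shows "tuple_dist n X x (restrict z {1..n}) \<le> tuple_dist (Suc n) X (x(Suc n := v)) z"
proof (rule tuple_dist_least[OF assms])
  fix j assume j: "j \<in> {1..n}"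
  then show "vnorm (X j) (x j \<ominus>\<^bsub>X j\<^esub> restrict z {1..n} j) \<le> tuple_dist (Suc n) X (x(Suc n := v)) z"
    using tuple_dist_upper[of j "Suc n" X "x(Suc n := v)" z] by simp
qed

locale banach_family_Suc = banach_family "Suc n" X
  for n :: nat and X :: "nat \<Rightarrow> ('k::real_or_complex, 'a) normed_space"
begin

abbreviation last_dual :: "('k, 'a \<Rightarrow> 'k) normed_space" where
  "last_dual \<equiv> dual_space (X (Suc n))"

sublocale init: banach_family n X
  by (rule banach_family.intro) (rule banach nonzero; simp)+

sublocale last: banach_space "X (Suc n)"
  by (rule banach) simp

lemma last_sphere: "unit_sphere (X (Suc n)) \<noteq> {}"
  using last.unit_sphere_nonempty nonzero[of "Suc n"] by simp

text \<open>Surjectivity of currying: every bounded map into the dual is curried from a scalar map.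
  The equality holds literally because maps and functionals are extensional, so both sides are
  \<open>undefined\<close> outside the tuples and outside the carrier.\<close>

lemma uncurry_curry:
  assumes A: "A \<in> bounded_multilinear_maps n X last_dual"
  shows "curry_last n X (uncurry_last n X A) = A"
proof
  fix x
  show "curry_last n X (uncurry_last n X A) x = A x"
  proof (cases "x \<in> tuples n X")
    case True
    have "curry_last n X (uncurry_last n X A) x v = A x v" for v
    proof (cases "v \<in> carrier (X (Suc n))")
      case v: True
      then show ?thesis
        using True PiE_Suc_upd[OF True v] PiE_restrict_upd[OF True, of v]
        by (simp add: curry_last_apply uncurry_last_apply del: One_nat_def restrict_apply)
    next
      case False
      then show ?thesis
        using True dual_ext[OF bounded_multilinear_closed[OF A True]]
        by (simp add: curry_last_def extensional_def)
    qed
    then show ?thesis by blast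
  next
    case False
    then show ?thesis
      using PiE_arb[OF bounded_multilinear_ext[OF A]] by (simp add: curry_last_def)
  qed
qed

text \<open>The bound K is kept, as a unit vector in the last slot contributes a factor 1. Linearity
  in each of the other slots is pointwise in the last one.\<close>

lemma curry_bounded:
  assumes C: "C \<in> bounded_multilinear_maps (Suc n) X scalar_space"
  shows "curry_last n X C \<in> bounded_multilinear_maps n X last_dual"
proof -
  obtain K where K: "\<forall>x\<in>tuples (Suc n) X. norm (C x) \<le> K * (\<Prod>i=1..Suc n. vnorm (X i) (x i))"
    using bounded_multilinear_bound[OF C] by auto
  have closed: "curry_last n X C x \<in> carrier last_dual" if x: "x \<in> tuples n X" for x
  proof -
    \<comment> \<open>The zero vector is a placeholder in the slot that the slice
      overwrites.\<close>
    have "x(Suc n := \<zero>\<^bsub>X (Suc n)\<^esub>) \<in> tuples (Suc n) X"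
      using x by (rule PiE_Suc_upd) simp
    from slice_in_dual[OF C last.banach_space_axioms this]
    show ?thesis using x by (simp add: curry_last_def)
  qed
  show ?thesis
  proof (rule bounded_multilinear_mapsI[where C = K])
    show "curry_last n X C \<in> tuples n X \<rightarrow>\<^sub>E carrier last_dual"
      using closed by (auto simp: PiE_iff extensional_def curry_last_def simp del: One_nat_def)
  next
    fix x i v w assume x: "x \<in> tuples n X" "i \<in> {1..n}" "v \<in> carrier (X i)" "w \<in> carrier (X i)"
    note t = init.tuples_upd_add[OF x] PiE_upd[OF x(1,2,3)] PiE_upd[OF x(1,2,4)]
    have "C (x(i := v \<oplus>\<^bsub>X i\<^esub> w, Suc n := u)) = C (x(i := v, Suc n := u)) + C (x(i := w, Suc n := u))"
      if u: "u \<in> carrier (X (Suc n))" for u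
      using bounded_multilinear_add[OF C PiE_Suc_upd[OF x(1) u], of i v w] x
      by (simp add: fun_upd_twist[of i])
    then show "curry_last n X C (x(i := v \<oplus>\<^bsub>X i\<^esub> w)) =
        curry_last n X C (x(i := v)) \<oplus>\<^bsub>last_dual\<^esub> curry_last n X C (x(i := w))"
      using t by (auto simp: curry_last_def fun_eq_iff)
  next
    fix x i c v assume x: "x \<in> tuples n X" "i \<in> {1..n}" "v \<in> carrier (X i)"
    note t = init.tuples_upd_smult[OF x, of c] PiE_upd[OF x(1,2,3)]
    have "C (x(i := c \<odot>\<^bsub>X i\<^esub> v, Suc n := u)) = c * C (x(i := v, Suc n := u))"
      if u: "u \<in> carrier (X (Suc n))" for u
      using bounded_multilinear_smult[OF C PiE_Suc_upd[OF x(1) u], of i v c] x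
      by (simp add: fun_upd_twist[of i])
    then show "curry_last n X C (x(i := c \<odot>\<^bsub>X i\<^esub> v)) = c \<odot>\<^bsub>last_dual\<^esub> curry_last n X C (x(i := v))"
      using t by (auto simp: curry_last_def fun_eq_iff)
  next
    fix x assume x: "x \<in> tuples n X"
    show "vnorm last_dual (curry_last n X C x) \<le> K * (\<Prod>i=1..n. vnorm (X i) (x i))"
    proof (rule dual_norm_least[OF last_sphere])
      fix v assume v: "v \<in> unit_sphere (X (Suc n))"
      have "(\<Prod>i=1..Suc n. vnorm (X i) ((x(Suc n := v)) i)) = (\<Prod>i=1..n. vnorm (X i) (x i))"
        using unit_sphereD(2)[OF v] by (simp add: prod.nat_ivl_Suc')
      then show "norm (curry_last n X C x v) \<le> K * (\<Prod>i=1..n. vnorm (X i) (x i))"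
        using K PiE_Suc_upd[OF x unit_sphereD(1)[OF v]] curry_last_apply[OF x unit_sphereD(1)[OF v], of C]
        by metis
    qed
  qed
qed

text \<open>Linearity has two sources: in the last slot it is that of the functional, in the others
  that of A. The bound is |A(x)(v)| \<le> |A(x)| |v|.\<close>

lemma uncurry_bounded:
  assumes A: "A \<in> bounded_multilinear_maps n X last_dual"
  shows "uncurry_last n X A \<in> bounded_multilinear_maps (Suc n) X scalar_space"
proof -
  obtain K where K: "\<forall>x\<in>tuples n X. vnorm last_dual (A x) \<le> K * (\<Prod>i=1..n. vnorm (X i) (x i))"
    using bounded_multilinear_bound[OF A] by auto
  have closed: "A (restrict x {1..n}) \<in> carrier last_dual" if "x \<in> tuples (Suc n) X" for x
    using bounded_multilinear_closed[OF A PiE_Suc_restrict[OF that]] .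
  have last_mem: "x (Suc n) \<in> carrier (X (Suc n))" if "x \<in> tuples (Suc n) X" for x
    using PiE_mem[OF that, of "Suc n"] by simp
  have restrict_init: "restrict (x(i := v)) {1..n} = (restrict x {1..n})(i := v)" if "i \<in> {1..n}"
    for x :: "nat \<Rightarrow> 'a" and i v
    using that by (auto simp: fun_eq_iff)
  have restrict_last: "restrict (x(Suc n := v)) {1..n} = restrict x {1..n}" for x :: "nat \<Rightarrow> 'a" and v
    by (auto simp: fun_eq_iff)
  show ?thesis
  proof (rule bounded_multilinear_mapsI[where C = K])
    fix x i v w
    assume x: "x \<in> tuples (Suc n) X" "i \<in> {1..Suc n}" "v \<in> carrier (X i)" "w \<in> carrier (X i)"
    note t = tuples_upd_add[OF x] PiE_upd[OF x(1,2,3)] PiE_upd[OF x(1,2,4)]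
    show "uncurry_last n X A (x(i := v \<oplus>\<^bsub>X i\<^esub> w)) =
      uncurry_last n X A (x(i := v)) \<oplus>\<^bsub>scalar_space\<^esub> uncurry_last n X A (x(i := w))"
    proof (cases "i = Suc n")
      case True
      then show ?thesis
        using t x(3,4) dual_add[OF closed[OF x(1)], of v w]
        by (simp add: uncurry_last_apply restrict_last del: restrict_apply One_nat_def)
    next
      case False
      then have i: "i \<in> {1..n}" using x(2) by simp
      show ?thesis
        using t i False bounded_multilinear_add[OF A PiE_Suc_restrict[OF x(1)] i x(3,4)] last_mem[OF x(1)]
        by (simp add: uncurry_last_apply restrict_init del: restrict_apply One_nat_def) simp
    qed
  next
    fix x i c v
    assume x: "x \<in> tuples (Suc n) X" "i \<in> {1..Suc n}" "v \<in> carrier (X i)"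
    note t = tuples_upd_smult[OF x, of c] PiE_upd[OF x(1,2,3)]
    show "uncurry_last n X A (x(i := c \<odot>\<^bsub>X i\<^esub> v)) = c \<odot>\<^bsub>scalar_space\<^esub> uncurry_last n X A (x(i := v))"
    proof (cases "i = Suc n")
      case True
      then show ?thesis
        using t x(3) dual_smult[OF closed[OF x(1)], of v c]
        by (simp add: uncurry_last_apply restrict_last del: restrict_apply One_nat_def)
    next
      case False
      then have i: "i \<in> {1..n}" using x(2) by simp
      show ?thesis
        using t i False bounded_multilinear_smult[OF A PiE_Suc_restrict[OF x(1)] i x(3), of c] last_mem[OF x(1)]
        by (simp add: uncurry_last_apply restrict_init del: restrict_apply One_nat_def) simp
    qed
  next
    fix x assume x: "x \<in> tuples (Suc n) X"
    have "norm (A (restrict x {1..n}) (x (Suc n))) \<le>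
        vnorm last_dual (A (restrict x {1..n})) * vnorm (X (Suc n)) (x (Suc n))"
      by (rule last.dual_norm_bound[OF closed[OF x] last_mem[OF x]])
    also have "\<dots> \<le> (K * (\<Prod>i=1..n. vnorm (X i) (restrict x {1..n} i))) * vnorm (X (Suc n)) (x (Suc n))"
      using K PiE_Suc_restrict[OF x] by (intro mult_right_mono last.vnorm_nonneg last_mem[OF x]) blast
    also have "(\<Prod>i=1..n. vnorm (X i) (restrict x {1..n} i)) = (\<Prod>i=1..n. vnorm (X i) (x i))"
      by (intro prod.cong) auto
    finally show "vnorm scalar_space (uncurry_last n X A x) \<le> K * (\<Prod>i=1..Suc n. vnorm (X i) (x i))"
      using x by (simp add: uncurry_last_apply prod.nat_ivl_Suc' mult_ac del: restrict_apply One_nat_def)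
  qed (simp add: uncurry_last_def)
qed

text \<open>A supremum over the product of spheres is an iterated supremum. Only boundedness of C is
  assumed, so that the identity covers differences of maps.\<close>

lemma opnorm_curry:
  assumes C: "bdd_above ((\<lambda>x. norm (C x)) ` spheres (Suc n) X)"
  shows "opnorm n X last_dual (curry_last n X C) = opnorm (Suc n) X scalar_space C"
proof (rule antisym)
  have upper: "norm (C x) \<le> opnorm (Suc n) X scalar_space C" if "x \<in> spheres (Suc n) X" for x
    using opnorm_upper_bdd[of scalar_space C "Suc n" X x] C that by simp
  have curry_le: "norm (curry_last n X C x v) \<le> opnorm (Suc n) X scalar_space C"
    if "x \<in> spheres n X" "v \<in> unit_sphere (X (Suc n))" for x v
    using upper[OF spheres_Suc_upd[OF that]] curry_last_apply[OF spheres_tuples[OF that(1)] unit_sphereD(1)[OF that(2)], of C]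
    by simp
  have dual_le: "vnorm last_dual (curry_last n X C x) \<le> opnorm (Suc n) X scalar_space C"
    if "x \<in> spheres n X" for x
    by (rule dual_norm_least[OF last_sphere curry_le[OF that]])
  then show "opnorm n X last_dual (curry_last n X C) \<le> opnorm (Suc n) X scalar_space C"
    by (rule opnorm_least[OF init.spheres_nonempty])
  show "opnorm (Suc n) X scalar_space C \<le> opnorm n X last_dual (curry_last n X C)"
  proof (rule opnorm_least[OF spheres_nonempty])
    fix x assume x: "x \<in> spheres (Suc n) X"
    note r = spheres_Suc_restrict[OF x]
    have v: "x (Suc n) \<in> unit_sphere (X (Suc n))" using spheresD[OF x] by simp
    have "norm (C x) = norm (curry_last n X C (restrict x {1..n}) (x (Suc n)))"
      unfolding curry_last_apply[OF spheres_tuples[OF r] unit_sphereD(1)[OF v]]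
      by (simp only: PiE_Suc_eta[OF spheres_tuples[OF x]])
    also have "\<dots> \<le> vnorm last_dual (curry_last n X C (restrict x {1..n}))"
      unfolding vnorm_dual_space
      by (rule cSUP_upper[OF v]) (rule bdd_aboveI2, rule curry_le[OF r])
    also have "\<dots> \<le> opnorm n X last_dual (curry_last n X C)"
      by (rule opnorm_upper_bdd[OF _ r]) (rule bdd_aboveI2, rule dual_le)
    finally show "vnorm scalar_space (C x) \<le> opnorm n X last_dual (curry_last n X C)" by simp
  qed
qed

lemma opnorm_curry_bounded:
  "C \<in> bounded_multilinear_maps (Suc n) X scalar_space \<Longrightarrow>
   opnorm n X last_dual (curry_last n X C) = opnorm (Suc n) X scalar_space C"
  using bdd_above_spheres by (intro opnorm_curry) fastforce

text \<open>Currying commutes with pointwise differences, so it preserves distances as well as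
  norms.\<close>

lemma opnorm_map_diff_curry:
  assumes A: "A \<in> bounded_multilinear_maps (Suc n) X scalar_space"
    and B: "B \<in> bounded_multilinear_maps (Suc n) X scalar_space"
  shows "opnorm n X last_dual (map_diff n X last_dual (curry_last n X B) (curry_last n X A)) =
    opnorm (Suc n) X scalar_space (map_diff (Suc n) X scalar_space B A)"
proof -
  have "map_diff n X last_dual (curry_last n X B) (curry_last n X A) =
      curry_last n X (map_diff (Suc n) X scalar_space B A)"
  proof
    fix x
    show "map_diff n X last_dual (curry_last n X B) (curry_last n X A) x =
      curry_last n X (map_diff (Suc n) X scalar_space B A) x"
    proof (cases "x \<in> tuples n X")
      case x: True
      have "curry_last n X B x \<ominus>\<^bsub>last_dual\<^esub> curry_last n X A x =
          (\<lambda>v\<in>carrier (X (Suc n)). curry_last n X B x v - curry_last n X A x v)"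
        by (intro last.minus_dual_space bounded_multilinear_closed[OF curry_bounded _] A B x)
      also have "\<dots> = curry_last n X (map_diff (Suc n) X scalar_space B A) x"
        using x PiE_Suc_upd[OF x]
        by (auto simp: curry_last_def map_diff_def fun_eq_iff simp del: One_nat_def)
      finally show ?thesis
        using x by (simp add: map_diff_def)
    next
      case False
      then show ?thesis by (simp add: map_diff_def curry_last_def)
    qed
  qed
  moreover have "bdd_above ((\<lambda>x. norm (map_diff (Suc n) X scalar_space B A x)) ` spheres (Suc n) X)"
    using bdd_above_map_diff[OF A B] by (simp add: norm_triangle_ineq4)
  ultimately show ?thesis by (simp add: opnorm_curry)
qed

text \<open>The last coordinate of x witnesses the norm of the functional at the remaining ones: its
  value there has modulus 1, and the operator norm allows no more.\<close>

lemma attained_curry: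
  assumes C: "C \<in> bounded_multilinear_maps (Suc n) X scalar_space" "opnorm (Suc n) X scalar_space C = 1"
    and x: "x \<in> spheres (Suc n) X" "norm (C x) = 1"
  shows "vnorm last_dual (curry_last n X C (restrict x {1..n})) = 1"
proof (rule antisym)
  note r = spheres_Suc_restrict[OF x(1)]
  have v: "x (Suc n) \<in> unit_sphere (X (Suc n))" using spheresD[OF x(1)] by simp
  show "vnorm last_dual (curry_last n X C (restrict x {1..n})) \<le> 1"
    using opnorm_upper[OF curry_bounded[OF C(1)] r] C by (simp add: opnorm_curry_bounded del: restrict_apply)
  have "1 = norm (curry_last n X C (restrict x {1..n}) (x (Suc n)))"
    unfolding curry_last_apply[OF spheres_tuples[OF r] unit_sphereD(1)[OF v]]
      PiE_Suc_eta[OF spheres_tuples[OF x(1)]] using x(2) by simp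
  also have "\<dots> \<le> vnorm last_dual (curry_last n X C (restrict x {1..n}))"
    by (intro norm_le_dual_norm v bounded_multilinear_closed[OF curry_bounded[OF C(1)]] spheres_tuples r)
  finally show "1 \<le> vnorm last_dual (curry_last n X C (restrict x {1..n}))" .
qed

text \<open>The dual norm is a supremum, so a strict lower bound passes to some unit vector v. This
  v depends on C as well as on x.\<close>

lemma nearly_attained_curry:
  assumes "x \<in> spheres n X" "vnorm last_dual (curry_last n X C x) > c"
  shows "\<exists>v\<in>unit_sphere (X (Suc n)). norm (C (x(Suc n := v))) > c"
proof (rule ccontr)
  assume "\<not> ?thesis"
  then have "norm (curry_last n X C x v) \<le> c" if "v \<in> unit_sphere (X (Suc n))" for v
    using that curry_last_apply[OF spheres_tuples[OF assms(1)] unit_sphereD(1)[OF that], of C] by auto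
  then show False
    using dual_norm_least[OF last_sphere, of "curry_last n X C x" c] assms(2) by force
qed

text \<open>The extended point is x with the unit vector v appended, where v is chosen after A. For
  \<open>BPBpp\<close> and \<open>BPBop\<close> the threshold is the same at all points, and for
  \<open>Loo\<close> it is attached to A; for \<open>Lpp\<close> it would be attached to the
  extended point, which is not known before A.\<close>

proposition curry_property:
  assumes n: "1 \<le> n" and P: "has_property P (Suc n) X (scalar_space :: ('k, 'k) normed_space)"
    and "P \<noteq> Lpp"
  shows "has_property P n X last_dual"
proof -
  let ?K = "scalar_space :: ('k, 'k) normed_space"
  have uncurry: "\<exists>C\<in>bounded_multilinear_maps (Suc n) X ?K. opnorm (Suc n) X ?K C = 1 \<and> A = curry_last n X C"
    if "A \<in> bounded_multilinear_maps n X last_dual" "opnorm n X last_dual A = 1" for A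
    using uncurry_bounded[OF that(1)] uncurry_curry[OF that(1)] that(2)
    by (metis opnorm_curry_bounded)
  consider "P = BPBop \<or> P = Loo" | "P = BPBpp" using assms(3) by (cases P) auto
  then show ?thesis
  proof cases
    case 1
    show ?thesis
    proof (rule op_transfer[OF _ 1 P])
      fix A assume A: "A \<in> bounded_multilinear_maps n X last_dual" "opnorm n X last_dual A = 1"
      obtain C where C: "C \<in> bounded_multilinear_maps (Suc n) X ?K" "opnorm (Suc n) X ?K C = 1"
        and A_eq: "A = curry_last n X C"
        using uncurry[OF A] by (elim bexE conjE) (rule that)
      show "\<exists>C\<in>bounded_multilinear_maps (Suc n) X ?K. opnorm (Suc n) X ?K C = 1 \<and>
        (\<forall>\<eta>. \<forall>x\<in>spheres n X. vnorm last_dual (A x) > 1 - \<eta> \<longrightarrow>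
          (\<exists>x'\<in>spheres (Suc n) X. vnorm ?K (C x') > 1 - \<eta> \<and>
            (\<forall>z'\<in>spheres (Suc n) X. vnorm ?K (C z') = 1 \<longrightarrow>
              (\<exists>z\<in>spheres n X. vnorm last_dual (A z) = 1 \<and>
                tuple_dist n X x z \<le> tuple_dist (Suc n) X x' z'))))"
      proof (intro bexI[OF _ C(1)] conjI C(2) allI ballI impI)
        fix \<eta> x assume x: "x \<in> spheres n X" "vnorm last_dual (A x) > 1 - \<eta>"
        obtain v where v: "v \<in> unit_sphere (X (Suc n))" "norm (C (x(Suc n := v))) > 1 - \<eta>"
          using nearly_attained_curry[OF x(1) x(2)[unfolded A_eq]] by blast
        show "\<exists>x'\<in>spheres (Suc n) X. vnorm ?K (C x') > 1 - \<eta> \<and>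
            (\<forall>z'\<in>spheres (Suc n) X. vnorm ?K (C z') = 1 \<longrightarrow>
              (\<exists>z\<in>spheres n X. vnorm last_dual (A z) = 1 \<and>
                tuple_dist n X x z \<le> tuple_dist (Suc n) X x' z'))"
        proof (intro bexI[OF _ spheres_Suc_upd[OF x(1) v(1)]] conjI ballI impI)
          show "vnorm ?K (C (x(Suc n := v))) > 1 - \<eta>" using v by simp
          fix z' assume z': "z' \<in> spheres (Suc n) X" "vnorm ?K (C z') = 1"
          show "\<exists>z\<in>spheres n X. vnorm last_dual (A z) = 1 \<and>
                tuple_dist n X x z \<le> tuple_dist (Suc n) X (x(Suc n := v)) z'"
            using attained_curry[OF C z'(1)] z'(2) tuple_dist_restrict[OF n, of X x z' v]
            by (intro bexI[OF _ spheres_Suc_restrict[OF z'(1)]]) (simp add: A_eq del: restrict_apply)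
        qed
      qed
    qed
  next
    case 2
    \<comment> \<open>\<open>pp_transfer\<close> asks for the point before the map, whereas v
      depends on A; the uniform \<eta> of \<open>BPBpp\<close> is therefore used directly.\<close>
    show ?thesis
      unfolding 2 has_property.simps has_BPBpp_def
    proof (intro allI impI)
      fix \<epsilon> :: real assume "\<epsilon> > 0"
      then have "\<exists>\<eta>>0. \<forall>C\<in>bounded_multilinear_maps (Suc n) X ?K. \<forall>x\<in>spheres (Suc n) X.
        opnorm (Suc n) X ?K C = 1 \<longrightarrow> vnorm ?K (C x) > 1 - \<eta> \<longrightarrow>
        (\<exists>B\<in>bounded_multilinear_maps (Suc n) X ?K. opnorm (Suc n) X ?K B = 1 \<and> vnorm ?K (B x) = 1 \<and>
          opnorm (Suc n) X ?K (map_diff (Suc n) X ?K B C) < \<epsilon>)"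
        using P unfolding 2 has_property.simps has_BPBpp_def by simp
      then obtain \<eta> where \<eta>: "\<eta> > 0" and pp: "\<forall>C\<in>bounded_multilinear_maps (Suc n) X ?K. \<forall>x\<in>spheres (Suc n) X.
        opnorm (Suc n) X ?K C = 1 \<longrightarrow> vnorm ?K (C x) > 1 - \<eta> \<longrightarrow>
        (\<exists>B\<in>bounded_multilinear_maps (Suc n) X ?K. opnorm (Suc n) X ?K B = 1 \<and> vnorm ?K (B x) = 1 \<and>
          opnorm (Suc n) X ?K (map_diff (Suc n) X ?K B C) < \<epsilon>)"
        by (elim exE conjE) (rule that)
      show "\<exists>\<eta>>0. \<forall>A\<in>bounded_multilinear_maps n X last_dual. \<forall>x\<in>spheres n X.
        opnorm n X last_dual A = 1 \<longrightarrow> vnorm last_dual (A x) > 1 - \<eta> \<longrightarrow>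
        (\<exists>B\<in>bounded_multilinear_maps n X last_dual. opnorm n X last_dual B = 1 \<and>
          vnorm last_dual (B x) = 1 \<and> opnorm n X last_dual (map_diff n X last_dual B A) < \<epsilon>)"
      proof (intro exI[of _ \<eta>] conjI \<eta> ballI impI)
        fix A x assume A: "A \<in> bounded_multilinear_maps n X last_dual" "opnorm n X last_dual A = 1"
          and x: "x \<in> spheres n X" "vnorm last_dual (A x) > 1 - \<eta>"
        obtain C where C: "C \<in> bounded_multilinear_maps (Suc n) X ?K" "opnorm (Suc n) X ?K C = 1"
          and A_eq: "A = curry_last n X C"
          using uncurry[OF A] by (elim bexE conjE) (rule that)
        obtain v where v: "v \<in> unit_sphere (X (Suc n))" "norm (C (x(Suc n := v))) > 1 - \<eta>"
          using nearly_attained_curry[OF x(1) x(2)[unfolded A_eq]] by blast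
        note xv = spheres_Suc_upd[OF x(1) v(1)]
        obtain B where B: "B \<in> bounded_multilinear_maps (Suc n) X ?K" "opnorm (Suc n) X ?K B = 1"
          "norm (B (x(Suc n := v))) = 1" "opnorm (Suc n) X ?K (map_diff (Suc n) X ?K B C) < \<epsilon>"
          using pp[rule_format, OF C(1) xv C(2)] v(2) by auto
        have "vnorm last_dual (curry_last n X B x) = 1"
          using attained_curry[OF B(1,2) xv B(3)] unfolding PiE_restrict_upd[OF spheres_tuples[OF x(1)]] .
        then show "\<exists>B\<in>bounded_multilinear_maps n X last_dual. opnorm n X last_dual B = 1 \<and>
          vnorm last_dual (B x) = 1 \<and> opnorm n X last_dual (map_diff n X last_dual B A) < \<epsilon>"
          using B(2,4) opnorm_curry_bounded[OF B(1)] opnorm_map_diff_curry[OF C(1) B(1)]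
          by (intro bexI[OF _ curry_bounded[OF B(1)]]) (simp add: A_eq)
      qed
    qed
  qed
qed

end

theorem proposition2p3:
  fixes P :: bpb_property and N :: nat
    and X :: "nat \<Rightarrow> ('k::real_or_complex, 'a) normed_space"
    and Y :: "('k, 'b) normed_space"
  assumes "N \<ge> 1"
    and "\<And>i. i \<in> {1..N} \<Longrightarrow> banach_space (X i)"
    and "\<And>i. i \<in> {1..N} \<Longrightarrow> carrier (X i) \<noteq> {\<zero>\<^bsub>X i\<^esub>}"
    and "banach_space Y"
    and "carrier Y \<noteq> {\<zero>\<^bsub>Y\<^esub>}"
  shows
    "(has_property P N X Y \<longrightarrow> has_property P N X (scalar_space :: ('k, 'k) normed_space)) \<and>
     (N \<ge> 2 \<and> has_property P N X (scalar_space :: ('k, 'k) normed_space) \<and> P \<noteq> Lpp \<longrightarrow>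
        has_property P (N - 1) X (dual_space (X N))) \<and>
     (has_property P N X Y \<longrightarrow>
        (\<forall>i\<in>{1..N}. has_property P 1 (\<lambda>_. X i) (scalar_space :: ('k, 'k) normed_space)))"
proof -
  interpret banach_family N X
    by (rule banach_family.intro) (use assms(2,3) in blast)+
  have a: "has_property P N X (scalar_space :: ('k, 'k) normed_space)" if "has_property P N X Y"
    using scalar_of_vector[OF assms(4,5) that] .
  have b: "has_property P (N - 1) X (dual_space (X N))"
    if "N \<ge> 2" "has_property P N X (scalar_space :: ('k, 'k) normed_space)" "P \<noteq> Lpp"
  proof -
    \<comment> \<open>With N = Suc n the space N is the last one and N - 1 is n; from N \<ge> 2
      comes \<open>1 \<le> n\<close>, so the distance of the shortened tuples is a maximum over a
      nonempty set.\<close>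
    obtain n where N: "N = Suc n" using assms(1) by (cases N) auto
    interpret S: banach_family_Suc n X
      using banach_family_axioms unfolding N banach_family_Suc_def .
    show ?thesis
      using S.curry_property that unfolding N by simp
  qed
  show ?thesis
    using a b factor_of_product by blast
qed

end
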